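(* Let $R$ be a local ring and let $n\ge 2$. Then the following two conditions are equivalent: (1) $T_n(R)$ is a strongly $\Delta$-clean ring; (2) $R$ is a bleached ring and $R/J(R)\cong\mathbb{F}_2$.
   Context: Rings are associative with identity, not necessarily commutative. $U(S)$ and $J(S)$ denote the group of units and the Jacobson radical of a ring $S$. $T_n(R)$ is the ring of $n\times n$ upper triangular matrices over $R$. For a ring $S$, $\Delta(S)=\{x\in S \mid 1-xu\in U(S)\text{ for all }u\in U(S)\}$; $S$ is strongly $\Delta$-clean if every $a\in S$ can be written $a=e+d$ with $e^2=e\in S$, $d\in\Delta(S)$ and $ed=de$. For $a,b\in R$, let $l_a-r_b:R\to R$ be the additive map $r\mapsto ar-rb$. A local ring $R$ is bleached if for all $a\in U(R)$ and $b\in J(R)$, both $l_a-r_b$ and $l_b-r_a$ are surjective. *)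

theory Defs
  imports "HOL-Algebra.Algebra"
begin

locale left_ideal = additive_subgroup I R + ring R for I and R (structure) +
  assumes l_mult_closed: "\<lbrakk>a \<in> I; x \<in> carrier R\<rbrakk> \<Longrightarrow> x \<otimes> a \<in> I"

locale maximal_left_ideal = left_ideal +
  assumes I_proper: "I \<noteq> carrier R"
    and I_maximal: "\<lbrakk>left_ideal J R; I \<subseteq> J\<rbrakk> \<Longrightarrow> J = I \<or> J = carrier R"

definition jacobson_radical :: "('a, 'm) ring_scheme \<Rightarrow> 'a set" where
  "jacobson_radical R = {x \<in> carrier R. \<forall>I. maximal_left_ideal I R \<longrightarrow> x \<in> I}"

text \<open>The zero ring has no maximal left ideal, so it is not local.\<close>

locale local_ring = ring R for R (structure) +
  assumes unique_maximal_left_ideal: "\<exists>!I. maximal_left_ideal I R"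

definition delta :: "('a, 'm) ring_scheme \<Rightarrow> 'a set" where
  "delta S = {x \<in> carrier S. \<forall>u \<in> Units S. \<one>\<^bsub>S\<^esub> \<ominus>\<^bsub>S\<^esub> x \<otimes>\<^bsub>S\<^esub> u \<in> Units S}"

locale strongly_delta_clean_ring = ring S for S (structure) +
  assumes strongly_delta_clean:
    "a \<in> carrier S \<Longrightarrow>
      \<exists>e \<in> carrier S. \<exists>d \<in> delta S. a = e \<oplus> d \<and> e \<otimes> e = e \<and> e \<otimes> d = d \<otimes> e"

definition lmult_minus_rmult :: "('a, 'm) ring_scheme \<Rightarrow> 'a \<Rightarrow> 'a \<Rightarrow> 'a \<Rightarrow> 'a" where
  "lmult_minus_rmult R a b r = a \<otimes>\<^bsub>R\<^esub> r \<ominus>\<^bsub>R\<^esub> r \<otimes>\<^bsub>R\<^esub> b"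

locale bleached_ring = local_ring R for R (structure) +
  assumes surj_unit_radical:
      "\<lbrakk>a \<in> Units R; b \<in> jacobson_radical R\<rbrakk> \<Longrightarrow>
        lmult_minus_rmult R a b ` carrier R = carrier R"
    and surj_radical_unit:
      "\<lbrakk>a \<in> Units R; b \<in> jacobson_radical R\<rbrakk> \<Longrightarrow>
        lmult_minus_rmult R b a ` carrier R = carrier R"

text \<open>
  Matrices are indexed by \<open>0, \<dots>, n - 1\<close>. A matrix is represented by its entry function, extended by
  \<open>\<zero>\<close> outside the \<open>n \<times> n\<close> square, so that upper triangular matrices are the functions supported on
  \<open>i \<le> j < n\<close> and each has exactly one representative.
\<close>

definition upper_triangular_ring ::
    "nat \<Rightarrow> ('a, 'm) ring_scheme \<Rightarrow> (nat \<Rightarrow> nat \<Rightarrow> 'a) ring" where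
  "upper_triangular_ring n R =
    \<lparr>carrier = {A. (\<forall>i j. A i j \<in> carrier R) \<and> (\<forall>i j. \<not> (i \<le> j \<and> j < n) \<longrightarrow> A i j = \<zero>\<^bsub>R\<^esub>)},
     monoid.mult = (\<lambda>A B i j. \<Oplus>\<^bsub>R\<^esub>k \<in> {..<n}. A i k \<otimes>\<^bsub>R\<^esub> B k j),
     one = (\<lambda>i j. if i = j \<and> i < n then \<one>\<^bsub>R\<^esub> else \<zero>\<^bsub>R\<^esub>),
     ring.zero = (\<lambda>i j. \<zero>\<^bsub>R\<^esub>),
     ring.add = (\<lambda>A B i j. A i j \<oplus>\<^bsub>R\<^esub> B i j)\<rparr>"

end

theory Submission
  imports Defs
begin

text \<open>
  In a local ring the units are the complement of \<open>J(R)\<close>, the only idempotents are \<open>0\<close> and \<open>1\<close>, and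
  a triangular matrix is invertible iff its diagonal entries are. Hence \<open>\<Delta>(T\<^sub>n(R))\<close> consists of the
  matrices with diagonal in \<open>J(R)\<close>, and a strongly \<open>\<Delta>\<close>-clean decomposition of \<open>A\<close> amounts to an idempotent
  that commutes with \<open>A\<close> and has the diagonal of \<open>A\<close> modulo \<open>J(R)\<close>.

  If such idempotents exist, every diagonal entry is \<open>0\<close> or \<open>1\<close> modulo \<open>J(R)\<close>, so the residue ring is the
  field with two elements; commuting with a matrix whose upper left block is \<open>(a c; 0 b)\<close> says in
  position \<open>(0, 1)\<close> that \<open>c = a r - r b\<close> (or its negative) for the entry \<open>r\<close> of the idempotent there.

  Conversely the idempotent is built one column at a time. Given an idempotent \<open>F\<close> for the leading block
  \<open>A\<close>, extend it to \<open>(F W; 0 e)\<close> for \<open>(A V; 0 b)\<close>. If \<open>b\<close> is a unit, take \<open>e = 1\<close>; one needs \<open>F W = 0\<close> and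
  \<open>A W - W b = F V - V\<close>. Replacing \<open>A\<close> by \<open>A (1 - F)\<close>, whose diagonal lies in \<open>J(R)\<close>, makes the equation
  solvable from the bottom row upwards because \<open>R\<close> is bleached, and multiplying the solution by \<open>1 - F\<close>
  repairs it. If \<open>b \<in> J(R)\<close>, take \<open>e = 0\<close> and use \<open>A F + (1 - F)\<close>, whose diagonal consists of units, and
  multiplication by \<open>F\<close>.
\<close>

section \<open>Local rings\<close>

text \<open>Negatives come from left multiplication by \<open>\<ominus> \<one>\<close>.\<close>

lemma (in ring) left_idealI:
  assumes "I \<subseteq> carrier R" and "\<zero> \<in> I"
    and "\<And>x y. \<lbrakk>x \<in> I; y \<in> I\<rbrakk> \<Longrightarrow> x \<oplus> y \<in> I"
    and "\<And>a x. \<lbrakk>a \<in> carrier R; x \<in> I\<rbrakk> \<Longrightarrow> a \<otimes> x \<in> I"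
  shows "left_ideal I R"
proof (intro left_ideal.intro left_ideal_axioms.intro additive_subgroupI ring_axioms)
  have "\<ominus> x \<in> I" if "x \<in> I" for x
  proof -
    have "\<ominus> x = \<ominus> \<one> \<otimes> x"
      using that assms(1) by (simp add: l_minus subset_iff)
    then show ?thesis
      using that assms(4) by simp
  qed
  then show "subgroup I (add_monoid R)"
    using assms by (intro group.subgroupI) (auto simp: add.group_axioms a_inv_def[symmetric])
qed (use assms in auto)

lemma (in left_ideal) one_imp_carrier: "\<one> \<in> I \<Longrightarrow> I = carrier R"
  using l_mult_closed[of \<one>] a_subset by force

text \<open>Zorn's lemma on the left ideals above \<open>I\<close> that avoid \<open>\<one>\<close>.
  Avoiding \<open>\<one>\<close> expresses properness in a form that passes to unions of
  chains.\<close>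

lemma (in ring) exists_maximal_left_ideal:
  assumes "left_ideal I R" and "\<one> \<notin> I"
  shows "\<exists>M. maximal_left_ideal M R \<and> I \<subseteq> M"
proof -
  define \<A> where "\<A> = {K. left_ideal K R \<and> \<one> \<notin> K \<and> I \<subseteq> K}"
  have I: "I \<in> \<A>"
    using assms by (simp add: \<A>_def)
  have "\<exists>M\<in>\<A>. \<forall>K\<in>\<A>. M \<subseteq> K \<longrightarrow> K = M"
  proof (rule subset_Zorn_nonempty)
    show "\<A> \<noteq> {}"
      using I by blast
  next
    fix \<C>
    assume ne: "\<C> \<noteq> {}" and chain: "subset.chain \<A> \<C>"
    have mem: "left_ideal K R" "\<one> \<notin> K" "I \<subseteq> K" if "K \<in> \<C>" for K
      using that chain by (auto simp: \<A>_def subset_chain_def)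
    have sub: "additive_subgroup K R" if "K \<in> \<C>" for K
      using mem(1)[OF that] by (simp add: left_ideal_def)
    have "left_ideal (\<Union>\<C>) R"
    proof (rule left_idealI)
      show "\<Union>\<C> \<subseteq> carrier R"
        using sub additive_subgroup.a_subset by blast
      show "\<zero> \<in> \<Union>\<C>"
        using ne sub additive_subgroup.zero_closed by blast
      show "x \<oplus> y \<in> \<Union>\<C>" if xy: "x \<in> \<Union>\<C>" "y \<in> \<Union>\<C>" for x y
      proof -
        obtain K L where "K \<in> \<C>" "L \<in> \<C>" "x \<in> K" "y \<in> L"
          using xy by blast
        moreover from this have "K \<subseteq> L \<or> L \<subseteq> K"
          using chain by (auto simp: subset_chain_def)
        ultimately show ?thesis
          using sub additive_subgroup.a_closed by (metis UnionI subsetD)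
      qed
      show "a \<otimes> x \<in> \<Union>\<C>" if "a \<in> carrier R" "x \<in> \<Union>\<C>" for a x
        using that mem(1) left_ideal.l_mult_closed by (metis Union_iff)
    qed
    then show "\<Union>\<C> \<in> \<A>"
      using mem ne unfolding \<A>_def by blast
  qed
  then obtain M where M: "left_ideal M R" "\<one> \<notin> M" "I \<subseteq> M"
    and max: "\<And>K. \<lbrakk>left_ideal K R; \<one> \<notin> K; I \<subseteq> K; M \<subseteq> K\<rbrakk> \<Longrightarrow> K = M"
    by (auto simp: \<A>_def)
  have "maximal_left_ideal M R"
  proof (intro maximal_left_ideal.intro maximal_left_ideal_axioms.intro M(1))
    show "M \<noteq> carrier R"
      using M(2) by auto
    show "K = M \<or> K = carrier R" if "left_ideal K R" "M \<subseteq> K" for K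
      using that max M(3) left_ideal.one_imp_carrier by blast
  qed
  then show ?thesis
    using M(3) by blast
qed

context local_ring
begin

text \<open>With only one maximal left ideal, the intersection of all of them is that ideal.\<close>

lemma maximal_left_ideal_radical: "maximal_left_ideal (jacobson_radical R) R"
proof -
  obtain M where M: "maximal_left_ideal M R"
    and uniq: "\<And>I. maximal_left_ideal I R \<Longrightarrow> I = M"
    using unique_maximal_left_ideal by blast
  have "additive_subgroup M R"
    using M by (simp add: maximal_left_ideal_def left_ideal_def)
  then have "M \<subseteq> carrier R"
    by (rule additive_subgroup.a_subset)
  then have "jacobson_radical R = M"
    unfolding jacobson_radical_def using M uniq by blast
  with M show ?thesis
    by simp
qed

sublocale radical: maximal_left_ideal "jacobson_radical R" R
  by (rule maximal_left_ideal_radical)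

lemma radical_carrier [simp]: "x \<in> jacobson_radical R \<Longrightarrow> x \<in> carrier R"
  by (rule radical.a_Hcarr)

lemma one_notin_radical: "\<one> \<notin> jacobson_radical R"
  using radical.one_imp_carrier radical.I_proper by blast

text \<open>Otherwise the left ideal \<open>R x\<close> is proper, hence contained in a maximal left
  ideal. The only one is \<open>J(R)\<close>, which would then contain \<open>x\<close>.\<close>

lemma exists_left_inverse:
  assumes x: "x \<in> carrier R" "x \<notin> jacobson_radical R"
  shows "\<exists>y\<in>carrier R. y \<otimes> x = \<one>"
proof (rule ccontr)
  assume no: "\<not> ?thesis"
  define I where "I = (\<lambda>r. r \<otimes> x) ` carrier R"
  have "left_ideal I R"
  proof (rule left_idealI)
    show "\<zero> \<in> I"
      unfolding I_def using x by (intro image_eqI[of _ _ \<zero>]) auto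
    show "a \<oplus> b \<in> I" if "a \<in> I" "b \<in> I" for a b
      using that x by (auto simp: I_def l_distr[symmetric])
    show "a \<otimes> b \<in> I" if "a \<in> carrier R" "b \<in> I" for a b
      using that x by (auto simp: I_def m_assoc[symmetric])
  qed (use x in \<open>auto simp: I_def\<close>)
  moreover have "\<one> \<notin> I"
    using no by (auto simp: I_def)
  ultimately obtain M where "maximal_left_ideal M R" "I \<subseteq> M"
    using exists_maximal_left_ideal by blast
  moreover have "x \<in> I"
    unfolding I_def using x by (intro image_eqI[of _ _ \<one>]) auto
  ultimately show False
    using x unique_maximal_left_ideal maximal_left_ideal_radical by blast
qed

text \<open>An element \<open>x\<close> outside \<open>J(R)\<close> has a left inverse
  \<open>y\<close>. Once \<open>y\<close> is known to lie outside \<open>J(R)\<close> too, it has a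
  left inverse \<open>z\<close>; then \<open>z = x\<close>, and \<open>y\<close> is a two-sided
  inverse.\<close>

lemma Units_local: "Units R = carrier R - jacobson_radical R"
proof (intro equalityI subsetI)
  fix x assume x: "x \<in> Units R"
  have "x \<notin> jacobson_radical R"
    using x one_notin_radical radical.l_mult_closed[of x "inv x"] by auto
  with x show "x \<in> carrier R - jacobson_radical R"
    by blast
next
  fix x assume "x \<in> carrier R - jacobson_radical R"
  then have x: "x \<in> carrier R" "x \<notin> jacobson_radical R"
    by auto
  then obtain y where y: "y \<in> carrier R" "y \<otimes> x = \<one>"
    using exists_left_inverse by blast
  \<comment> \<open>If \<open>y\<close> were in \<open>J(R)\<close>, so would be \<open>x y\<close>,
    and \<open>1 - x y\<close> would be left invertible. But
    \<open>(1 - x y) x = x - x (y x) = 0\<close>, so \<open>x = 0\<close> would lie in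
    \<open>J(R)\<close>.\<close>
  have "y \<notin> jacobson_radical R"
  proof
    assume "y \<in> jacobson_radical R"
    then have xy: "x \<otimes> y \<in> jacobson_radical R"
      using x by (intro radical.l_mult_closed)
    have "\<one> \<ominus> x \<otimes> y \<notin> jacobson_radical R"
    proof
      assume "\<one> \<ominus> x \<otimes> y \<in> jacobson_radical R"
      then have "\<one> \<ominus> x \<otimes> y \<oplus> x \<otimes> y \<in> jacobson_radical R"
        using xy by (rule radical.a_closed)
      moreover have "\<one> \<ominus> x \<otimes> y \<oplus> x \<otimes> y = \<one>"
        using x y by (simp add: minus_eq a_assoc l_neg)
      ultimately show False
        using one_notin_radical by simp
    qed
    then obtain z where z: "z \<in> carrier R" "z \<otimes> (\<one> \<ominus> x \<otimes> y) = \<one>"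
      using exists_left_inverse x y by (meson m_closed minus_closed one_closed)
    have "(\<one> \<ominus> x \<otimes> y) \<otimes> x = \<zero>"
      using x y by (simp add: minus_eq l_distr l_minus m_assoc r_neg)
    moreover have "z \<otimes> ((\<one> \<ominus> x \<otimes> y) \<otimes> x) = x"
      using x y z by (subst m_assoc[symmetric]) auto
    ultimately have "x = \<zero>"
      using z by simp
    then show False
      using x radical.zero_closed by simp
  qed
  then obtain z where z: "z \<in> carrier R" "z \<otimes> y = \<one>"
    using exists_left_inverse y by blast
  then have "z = x"
    using x y by (intro inv_unique[OF z(2) y(2)])
  then have "x \<otimes> y = \<one>"
    using z by simp
  then show "x \<in> Units R"
    unfolding Units_def using x y by blast
qed

lemma radical_not_unit: "x \<in> jacobson_radical R \<Longrightarrow> x \<notin> Units R"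
  by (simp add: Units_local)

text \<open>If \<open>x r\<close> were a unit, \<open>x\<close> would have the right inverse
  \<open>s = r (x r)^-1\<close>. Either \<open>s\<close> lies in \<open>J(R)\<close>, and then so
  does \<open>x s = 1\<close>, or \<open>s\<close> is a unit and so is its inverse \<open>x\<close>;
  both are absurd.\<close>

lemma radical_r_mult_closed:
  assumes x: "x \<in> jacobson_radical R" and r: "r \<in> carrier R"
  shows "x \<otimes> r \<in> jacobson_radical R"
proof (rule ccontr)
  assume "x \<otimes> r \<notin> jacobson_radical R"
  then have u: "x \<otimes> r \<in> Units R"
    using assms by (simp add: Units_local)
  define s where "s = r \<otimes> inv (x \<otimes> r)"
  have s: "s \<in> carrier R" "x \<otimes> s = \<one>"
    using u r x by (auto simp: s_def m_assoc[symmetric])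
  show False
  proof (cases "s \<in> jacobson_radical R")
    case True
    then show False
      using s x one_notin_radical radical.l_mult_closed[of s x] by simp
  next
    case False
    then have "s \<in> Units R"
      using s by (simp add: Units_local)
    then have "x = inv s"
      using s x by (metis Units_closed Units_inv_closed Units_r_inv inv_unique radical_carrier)
    then show False
      using x \<open>s \<in> Units R\<close> radical_not_unit by auto
  qed
qed

lemma ideal_radical: "ideal (jacobson_radical R) R"
  by (rule idealI)
    (auto intro: ring_axioms radical.a_subgroup radical.l_mult_closed radical_r_mult_closed)

lemma radical_minus_closed:
  assumes "x \<in> jacobson_radical R" "y \<in> jacobson_radical R"
  shows "x \<ominus> y \<in> jacobson_radical R"
  using assms by (simp add: minus_eq)

lemma unit_minus_radical:
  assumes u: "u \<in> Units R" and x: "x \<in> jacobson_radical R"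
  shows "u \<ominus> x \<in> Units R"
proof (rule ccontr)
  assume "u \<ominus> x \<notin> Units R"
  then have "u \<ominus> x \<in> jacobson_radical R"
    using u x by (simp add: Units_local)
  then have "u \<ominus> x \<oplus> x \<in> jacobson_radical R"
    using x by simp
  moreover have "u \<ominus> x \<oplus> x = u"
    using u x by (simp add: minus_eq a_assoc l_neg Units_closed)
  ultimately show False
    using u radical_not_unit by simp
qed

text \<open>One of \<open>e\<close> and \<open>1 - e\<close> is a unit and can be cancelled from
  \<open>e e = e\<close> or from \<open>(1 - e) e = 0\<close>. The conditional form later evaluates
  the diagonal of an idempotent matrix.\<close>

lemma idempotent_local:
  assumes e: "e \<in> carrier R" "e \<otimes> e = e"
  shows "e = (if e \<in> jacobson_radical R then \<zero> else \<one>)"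
proof (cases "e \<in> jacobson_radical R")
  case True
  then have "\<one> \<ominus> e \<in> Units R"
    by (simp add: unit_minus_radical)
  moreover have "(\<one> \<ominus> e) \<otimes> e = (\<one> \<ominus> e) \<otimes> \<zero>"
    using e by (simp add: minus_eq l_distr l_minus r_neg)
  ultimately have "e = \<zero>"
    using e by (metis Units_l_cancel zero_closed)
  with True show ?thesis
    by simp
next
  case False
  then have "e \<in> Units R"
    using e by (simp add: Units_local)
  moreover have "e \<otimes> e = e \<otimes> \<one>"
    using e by simp
  ultimately have "e = \<one>"
    using e by (metis Units_l_cancel one_closed)
  with False show ?thesis
    by simp
qed

end

section \<open>The residue ring\<close>

text \<open>Parity decides which coset of the even integers contains a number, so there are two
  cosets. \<open>ZFact 2\<close> is the model of the field with two elements.\<close>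

lemma ZFact_two:
  shows "carrier (ZFact 2) = {\<zero>\<^bsub>ZFact 2\<^esub>, \<one>\<^bsub>ZFact 2\<^esub>}"
    and "\<one>\<^bsub>ZFact 2\<^esub> \<noteq> \<zero>\<^bsub>ZFact 2\<^esub>"
    and "\<one>\<^bsub>ZFact 2\<^esub> \<oplus>\<^bsub>ZFact 2\<^esub> \<one>\<^bsub>ZFact 2\<^esub> = \<zero>\<^bsub>ZFact 2\<^esub>"
proof -
  define I where "I = Idl\<^bsub>\<Z>\<^esub> {2}"
  have mem: "x \<in> I \<longleftrightarrow> even x" for x
    by (auto simp: I_def int_Idl)
  have coset: "x \<in> I +>\<^bsub>\<Z>\<^esub> a \<longleftrightarrow> even (x - a)" for x a
  proof -
    have "x \<in> I +>\<^bsub>\<Z>\<^esub> a \<longleftrightarrow> (\<exists>h. even h \<and> x = h + a)"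
      by (auto simp: a_r_coset_def' mem)
    also have "\<dots> \<longleftrightarrow> even (x - a)"
      by (metis add_diff_cancel_right' diff_add_cancel)
    finally show ?thesis .
  qed
  have coset_eq: "I +>\<^bsub>\<Z>\<^esub> a = (if even a then I else I +>\<^bsub>\<Z>\<^esub> 1)" for a
    using coset mem by auto
  have I: "ideal I \<Z>"
    unfolding I_def by (simp add: int.genideal_ideal)
  have "carrier (ZFact 2) = range (\<lambda>a. I +>\<^bsub>\<Z>\<^esub> a)"
    by (auto simp: ZFact_def FactRing_def A_RCOSETS_def' I_def)
  also have "\<dots> = {I, I +>\<^bsub>\<Z>\<^esub> 1}"
  proof
    show "range (\<lambda>a. I +>\<^bsub>\<Z>\<^esub> a) \<subseteq> {I, I +>\<^bsub>\<Z>\<^esub> 1}"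
      using coset_eq by (metis image_subsetI insertCI)
    have "I = I +>\<^bsub>\<Z>\<^esub> 0"
      using coset_eq[of 0] by simp
    then show "{I, I +>\<^bsub>\<Z>\<^esub> 1} \<subseteq> range (\<lambda>a. I +>\<^bsub>\<Z>\<^esub> a)"
      by blast
  qed
  finally have Z: "carrier (ZFact 2) = {I, I +>\<^bsub>\<Z>\<^esub> 1}" "\<zero>\<^bsub>ZFact 2\<^esub> = I" "\<one>\<^bsub>ZFact 2\<^esub> = I +>\<^bsub>\<Z>\<^esub> 1"
    by (simp_all add: ZFact_def FactRing_def I_def)
  show "carrier (ZFact 2) = {\<zero>\<^bsub>ZFact 2\<^esub>, \<one>\<^bsub>ZFact 2\<^esub>}"
    by (simp add: Z)
  have "1 \<in> I +>\<^bsub>\<Z>\<^esub> 1" "1 \<notin> I"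
    by (simp_all add: coset mem)
  then show "\<one>\<^bsub>ZFact 2\<^esub> \<noteq> \<zero>\<^bsub>ZFact 2\<^esub>"
    by (auto simp: Z)
  have "\<one>\<^bsub>ZFact 2\<^esub> \<oplus>\<^bsub>ZFact 2\<^esub> \<one>\<^bsub>ZFact 2\<^esub> = I +>\<^bsub>\<Z>\<^esub> 2"
    using ideal.a_rcos_sum[OF I, of 1 1]
    by (simp add: Z) (simp add: ZFact_def FactRing_def)
  then show "\<one>\<^bsub>ZFact 2\<^esub> \<oplus>\<^bsub>ZFact 2\<^esub> \<one>\<^bsub>ZFact 2\<^esub> = \<zero>\<^bsub>ZFact 2\<^esub>"
    using coset_eq[of 2] by (simp add: Z)
qed

text \<open>By counting: otherwise the cosets of \<open>0\<close>, \<open>1\<close> and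
  \<open>a\<close> are three different elements of a ring with two.\<close>

lemma (in local_ring) quotient_two_elementsD:
  assumes iso: "R Quot (jacobson_radical R) \<simeq> ZFact 2" and a: "a \<in> carrier R"
  shows "a \<in> jacobson_radical R \<or> a \<ominus> \<one> \<in> jacobson_radical R"
proof (rule ccontr)
  let ?J = "jacobson_radical R"
  assume "\<not> ?thesis"
  then have "a \<ominus> \<zero> \<notin> ?J" "a \<ominus> \<one> \<notin> ?J" "\<one> \<ominus> \<zero> \<notin> ?J"
    using a one_notin_radical by (simp_all add: minus_eq)
  then have ne: "?J +> a \<noteq> ?J +> \<zero>" "?J +> a \<noteq> ?J +> \<one>" "?J +> \<one> \<noteq> ?J +> \<zero>"
    using a quotient_eq_iff_same_a_r_cos[OF ideal_radical] by auto
  have card: "card (carrier (R Quot ?J)) = 2"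
    using ring_iso_same_card[OF iso] ZFact_two by simp
  have "{?J +> \<zero>, ?J +> \<one>, ?J +> a} \<subseteq> carrier (R Quot ?J)"
    using a by (auto simp: FactRing_def A_RCOSETS_def')
  \<comment> \<open>An infinite set has \<open>card\<close> equal to \<open>0\<close>, so
    cardinality \<open>2\<close> gives finiteness.\<close>
  moreover have "finite (carrier (R Quot ?J))"
    using card by (intro card_ge_0_finite) simp
  ultimately have "card {?J +> \<zero>, ?J +> \<one>, ?J +> a} \<le> 2"
    unfolding card[symmetric] by (intro card_mono)
  moreover have "card {?J +> \<zero>, ?J +> \<one>, ?J +> a} = 3"
    using ne by (simp add: eq_commute)
  ultimately show False
    by simp
qed

text \<open>The map \<open>h\<close> sending \<open>J(R)\<close> to \<open>0\<close> and everything
  else to \<open>1\<close> is a surjective ring homomorphism with kernel \<open>J(R)\<close>; the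
  first isomorphism theorem does the rest.\<close>

lemma (in local_ring) quotient_two_elementsI:
  assumes two: "\<And>a. a \<in> carrier R \<Longrightarrow> a \<in> jacobson_radical R \<or> a \<ominus> \<one> \<in> jacobson_radical R"
  shows "R Quot (jacobson_radical R) \<simeq> ZFact 2"
proof -
  let ?J = "jacobson_radical R"
  interpret F: cring "ZFact 2"
    by (rule ZFact_is_cring)
  define h where "h a = (if a \<in> ?J then \<zero>\<^bsub>ZFact 2\<^esub> else \<one>\<^bsub>ZFact 2\<^esub>)" for a
  have add_radical: "a \<oplus> x \<in> ?J \<longleftrightarrow> a \<in> ?J" if "a \<in> carrier R" "x \<in> ?J" for a x
  proof
    assume "a \<oplus> x \<in> ?J"
    then have "a \<oplus> x \<ominus> x \<in> ?J"
      using that by (simp add: radical_minus_closed)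
    then show "a \<in> ?J"
      using that by (simp add: minus_eq a_assoc r_neg)
  qed (use that in simp)
  have two': "\<exists>x\<in>?J. a = \<one> \<oplus> x" if "a \<in> carrier R" "a \<notin> ?J" for a
  proof
    show "a = \<one> \<oplus> (a \<ominus> \<one>)"
      using that by (simp add: minus_eq a_lcomm r_neg)
    show "a \<ominus> \<one> \<in> ?J"
      using two that by blast
  qed
  \<comment> \<open>The hypothesis for \<open>1 + 1\<close> leaves only \<open>1 + 1\<close> in
    \<open>J(R)\<close>, as the alternative would put \<open>1\<close> there. This makes
    \<open>h\<close> additive on two elements outside \<open>J(R)\<close>.\<close>
  have "\<one> \<oplus> \<one> \<ominus> \<one> = \<one>"
    by (simp add: minus_eq a_assoc r_neg)
  then have char_two: "\<one> \<oplus> \<one> \<in> ?J"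
    using two[of "\<one> \<oplus> \<one>"] one_notin_radical by auto
  have "h \<in> ring_hom R (ZFact 2)"
  proof (rule ring_hom_memI)
    fix a b assume a: "a \<in> carrier R" and b: "b \<in> carrier R"
    have "a \<otimes> b \<notin> ?J" if "a \<notin> ?J" "b \<notin> ?J"
      using that a b Units_local by (metis Diff_iff Units_m_closed)
    then show "h (a \<otimes> b) = h a \<otimes>\<^bsub>ZFact 2\<^esub> h b"
      using a b by (auto simp: h_def radical.l_mult_closed radical_r_mult_closed)
    show "h (a \<oplus> b) = h a \<oplus>\<^bsub>ZFact 2\<^esub> h b"
    proof (cases "a \<in> ?J \<or> b \<in> ?J")
      case True
      then show ?thesis
        using a b add_radical[of a b] add_radical[of b a] by (auto simp: h_def a_comm)
    next
      case False
      then obtain x y where x: "x \<in> ?J" "a = \<one> \<oplus> x" and y: "y \<in> ?J" "b = \<one> \<oplus> y"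
        using two' a b by meson
      have "a \<oplus> b = \<one> \<oplus> \<one> \<oplus> (x \<oplus> y)"
        using x y by (simp add: a_ac)
      also have "\<dots> \<in> ?J"
        using x y char_two by simp
      finally show ?thesis
        using False by (simp add: h_def ZFact_two)
    qed
  qed (auto simp: h_def one_notin_radical)
  then interpret h: ring_hom_ring R "ZFact 2" h
    by (rule ring_hom_ringI2[OF ring_axioms F.ring_axioms])
  have "h ` carrier R = carrier (ZFact 2)"
    using one_notin_radical radical.zero_closed unfolding ZFact_two(1) h_def by force
  moreover have "a_kernel R (ZFact 2) h = ?J"
    by (auto simp: a_kernel_def' h_def ZFact_two split: if_splits)
  ultimately show ?thesis
    using h.FactRing_iso by simp
qed

section \<open>Upper triangular matrices\<close>

lemma (in abelian_monoid) finsum_swap: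
  assumes "finite A" "finite B" "\<And>i j. \<lbrakk>i \<in> A; j \<in> B\<rbrakk> \<Longrightarrow> f i j \<in> carrier G"
  shows "(\<Oplus>i\<in>A. \<Oplus>j\<in>B. f i j) = (\<Oplus>j\<in>B. \<Oplus>i\<in>A. f i j)"
  using assms(1,3)
proof (induction rule: finite_induct)
  case empty
  then show ?case
    by simp
next
  case (insert a A)
  then have "(\<Oplus>i\<in>insert a A. \<Oplus>j\<in>B. f i j) = (\<Oplus>j\<in>B. f a j) \<oplus> (\<Oplus>j\<in>B. \<Oplus>i\<in>A. f i j)"
    by (simp add: Pi_def)
  also have "\<dots> = (\<Oplus>j\<in>B. f a j \<oplus> (\<Oplus>i\<in>A. f i j))"
    using insert.prems by (intro finsum_addf[symmetric]) auto
  also have "\<dots> = (\<Oplus>j\<in>B. \<Oplus>i\<in>insert a A. f i j)"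
    using insert by (intro finsum_cong') auto
  finally show ?case .
qed

lemma (in abelian_monoid) finsum_eq_single:
  assumes "finite A" "i \<in> A" "f i \<in> carrier G" "\<And>k. \<lbrakk>k \<in> A; k \<noteq> i\<rbrakk> \<Longrightarrow> f k = \<zero>"
  shows "finsum G f A = f i"
proof -
  have "finsum G f A = (\<Oplus>k\<in>A. if i = k then f k else \<zero>)"
    using assms by (intro finsum_cong') (auto split: if_splits)
  also have "\<dots> = (\<Oplus>k\<in>A. if i = k then f i else \<zero>)"
    using assms by (intro finsum_cong') auto
  also have "\<dots> = f i"
    using assms by (intro finsum_singleton) auto
  finally show ?thesis .
qed

context ring
begin

abbreviation "T n \<equiv> upper_triangular_ring n R"

lemma triangular_carrier_iff:
  "A \<in> carrier (T n) \<longleftrightarrow>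
    (\<forall>i j. A i j \<in> carrier R) \<and> (\<forall>i j. \<not> (i \<le> j \<and> j < n) \<longrightarrow> A i j = \<zero>)"
  by (simp add: upper_triangular_ring_def)

lemma triangular_entry [simp]: "A \<in> carrier (T n) \<Longrightarrow> A i j \<in> carrier R"
  by (simp add: triangular_carrier_iff)

lemma triangular_entry_zero: "\<lbrakk>A \<in> carrier (T n); \<not> (i \<le> j \<and> j < n)\<rbrakk> \<Longrightarrow> A i j = \<zero>"
  unfolding triangular_carrier_iff by blast

lemma triangular_simps:
  "(A \<otimes>\<^bsub>T n\<^esub> B) i j = (\<Oplus>k\<in>{..<n}. A i k \<otimes> B k j)"
  "(A \<oplus>\<^bsub>T n\<^esub> B) i j = A i j \<oplus> B i j"
  "\<one>\<^bsub>T n\<^esub> i j = (if i = j \<and> i < n then \<one> else \<zero>)"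
  "\<zero>\<^bsub>T n\<^esub> i j = \<zero>"
  unfolding upper_triangular_ring_def by (simp_all only: ring.simps monoid.simps)

lemma triangular_mult_closed:
  assumes A: "A \<in> carrier (T n)" and B: "B \<in> carrier (T n)"
  shows "A \<otimes>\<^bsub>T n\<^esub> B \<in> carrier (T n)"
proof -
  have "A i k \<otimes> B k j = \<zero>" if "\<not> (i \<le> j \<and> j < n)" for i j k
  proof (cases "i \<le> k \<and> k < n")
    case True
    then have "B k j = \<zero>"
      using that by (intro triangular_entry_zero[OF B]) linarith
    then show ?thesis
      using A by simp
  next
    case False
    then show ?thesis
      using triangular_entry_zero[OF A] B by simp
  qed
  then show ?thesis
    using A B by (auto simp: triangular_carrier_iff triangular_simps intro!: finsum_closed)
qed

lemma triangular_one_closed: "\<one>\<^bsub>T n\<^esub> \<in> carrier (T n)"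
  by (auto simp: triangular_carrier_iff triangular_simps)

lemma triangular_mult_assoc:
  assumes A: "A \<in> carrier (T n)" and B: "B \<in> carrier (T n)" and C: "C \<in> carrier (T n)"
  shows "A \<otimes>\<^bsub>T n\<^esub> B \<otimes>\<^bsub>T n\<^esub> C = A \<otimes>\<^bsub>T n\<^esub> (B \<otimes>\<^bsub>T n\<^esub> C)"
proof (intro ext)
  fix i j
  have "(A \<otimes>\<^bsub>T n\<^esub> B \<otimes>\<^bsub>T n\<^esub> C) i j = (\<Oplus>k\<in>{..<n}. \<Oplus>l\<in>{..<n}. A i l \<otimes> B l k \<otimes> C k j)"
    unfolding triangular_simps using A B C
    by (intro finsum_cong' finsum_ldistr) auto
  also have "\<dots> = (\<Oplus>l\<in>{..<n}. \<Oplus>k\<in>{..<n}. A i l \<otimes> B l k \<otimes> C k j)"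
    using A B C by (intro finsum_swap) auto
  also have "\<dots> = (\<Oplus>l\<in>{..<n}. \<Oplus>k\<in>{..<n}. A i l \<otimes> (B l k \<otimes> C k j))"
    using A B C by (intro finsum_cong') (auto simp: m_assoc)
  also have "\<dots> = (A \<otimes>\<^bsub>T n\<^esub> (B \<otimes>\<^bsub>T n\<^esub> C)) i j"
    unfolding triangular_simps using A B C
    by (intro finsum_cong' finsum_rdistr[symmetric]) auto
  finally show "(A \<otimes>\<^bsub>T n\<^esub> B \<otimes>\<^bsub>T n\<^esub> C) i j = (A \<otimes>\<^bsub>T n\<^esub> (B \<otimes>\<^bsub>T n\<^esub> C)) i j" .
qed

lemma ring_upper_triangular: "ring (T n)"
proof (rule ringI)
  show "abelian_group (T n)"
  proof (rule abelian_groupI)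
    fix A assume A: "A \<in> carrier (T n)"
    show "\<exists>B\<in>carrier (T n). B \<oplus>\<^bsub>T n\<^esub> A = \<zero>\<^bsub>T n\<^esub>"
    proof
      show "(\<lambda>i j. \<ominus> A i j) \<in> carrier (T n)"
        using A by (auto simp: triangular_carrier_iff)
      show "(\<lambda>i j. \<ominus> A i j) \<oplus>\<^bsub>T n\<^esub> A = \<zero>\<^bsub>T n\<^esub>"
        using A by (intro ext) (simp add: triangular_simps l_neg)
    qed
  qed (auto simp: triangular_carrier_iff triangular_simps fun_eq_iff a_ac)
  show "monoid (T n)"
  proof (rule monoidI)
    fix A assume A: "A \<in> carrier (T n)"
    show "\<one>\<^bsub>T n\<^esub> \<otimes>\<^bsub>T n\<^esub> A = A"
    proof (intro ext)
      fix i j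
      show "(\<one>\<^bsub>T n\<^esub> \<otimes>\<^bsub>T n\<^esub> A) i j = A i j"
      proof (cases "i < n")
        case True
        then have "(\<one>\<^bsub>T n\<^esub> \<otimes>\<^bsub>T n\<^esub> A) i j = \<one>\<^bsub>T n\<^esub> i i \<otimes> A i j"
          unfolding triangular_simps(1)
          using A by (intro finsum_eq_single) (auto simp: triangular_simps)
        then show ?thesis
          using A True by (simp add: triangular_simps)
      next
        case False
        then have "A i j = \<zero>"
          by (intro triangular_entry_zero[OF A]) linarith
        moreover have "\<one>\<^bsub>T n\<^esub> \<otimes>\<^bsub>T n\<^esub> A \<in> carrier (T n)"
          using A by (intro triangular_mult_closed triangular_one_closed)
        ultimately show ?thesis
          using False by (auto intro!: triangular_entry_zero)
      qed
    qed
    show "A \<otimes>\<^bsub>T n\<^esub> \<one>\<^bsub>T n\<^esub> = A"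
    proof (intro ext)
      fix i j
      show "(A \<otimes>\<^bsub>T n\<^esub> \<one>\<^bsub>T n\<^esub>) i j = A i j"
      proof (cases "j < n")
        case True
        then have "(A \<otimes>\<^bsub>T n\<^esub> \<one>\<^bsub>T n\<^esub>) i j = A i j \<otimes> \<one>\<^bsub>T n\<^esub> j j"
          unfolding triangular_simps(1)
          using A by (intro finsum_eq_single) (auto simp: triangular_simps)
        then show ?thesis
          using A True by (simp add: triangular_simps)
      next
        case False
        moreover have "A \<otimes>\<^bsub>T n\<^esub> \<one>\<^bsub>T n\<^esub> \<in> carrier (T n)"
          using A by (intro triangular_mult_closed triangular_one_closed)
        ultimately show ?thesis
          using A by (simp add: triangular_entry_zero)
      qed
    qed
  qed (auto intro: triangular_mult_closed triangular_one_closed triangular_mult_assoc)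
next
  fix A B C
  assume A: "A \<in> carrier (T n)" and B: "B \<in> carrier (T n)" and C: "C \<in> carrier (T n)"
  show "(A \<oplus>\<^bsub>T n\<^esub> B) \<otimes>\<^bsub>T n\<^esub> C = A \<otimes>\<^bsub>T n\<^esub> C \<oplus>\<^bsub>T n\<^esub> B \<otimes>\<^bsub>T n\<^esub> C"
  proof (intro ext)
    fix i j
    have "(\<Oplus>k\<in>{..<n}. (A i k \<oplus> B i k) \<otimes> C k j) = (\<Oplus>k\<in>{..<n}. A i k \<otimes> C k j \<oplus> B i k \<otimes> C k j)"
      using A B C by (intro finsum_cong') (auto simp: l_distr)
    also have "\<dots> = (\<Oplus>k\<in>{..<n}. A i k \<otimes> C k j) \<oplus> (\<Oplus>k\<in>{..<n}. B i k \<otimes> C k j)"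
      using A B C by (intro finsum_addf) auto
    finally show "((A \<oplus>\<^bsub>T n\<^esub> B) \<otimes>\<^bsub>T n\<^esub> C) i j = (A \<otimes>\<^bsub>T n\<^esub> C \<oplus>\<^bsub>T n\<^esub> B \<otimes>\<^bsub>T n\<^esub> C) i j"
      by (simp only: triangular_simps)
  qed
  show "C \<otimes>\<^bsub>T n\<^esub> (A \<oplus>\<^bsub>T n\<^esub> B) = C \<otimes>\<^bsub>T n\<^esub> A \<oplus>\<^bsub>T n\<^esub> C \<otimes>\<^bsub>T n\<^esub> B"
  proof (intro ext)
    fix i j
    have "(\<Oplus>k\<in>{..<n}. C i k \<otimes> (A k j \<oplus> B k j)) = (\<Oplus>k\<in>{..<n}. C i k \<otimes> A k j \<oplus> C i k \<otimes> B k j)"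
      using A B C by (intro finsum_cong') (auto simp: r_distr)
    also have "\<dots> = (\<Oplus>k\<in>{..<n}. C i k \<otimes> A k j) \<oplus> (\<Oplus>k\<in>{..<n}. C i k \<otimes> B k j)"
      using A B C by (intro finsum_addf) auto
    finally show "(C \<otimes>\<^bsub>T n\<^esub> (A \<oplus>\<^bsub>T n\<^esub> B)) i j = (C \<otimes>\<^bsub>T n\<^esub> A \<oplus>\<^bsub>T n\<^esub> C \<otimes>\<^bsub>T n\<^esub> B) i j"
      by (simp only: triangular_simps)
  qed
qed

lemma triangular_minus:
  assumes A: "A \<in> carrier (T n)" and B: "B \<in> carrier (T n)"
  shows "(A \<ominus>\<^bsub>T n\<^esub> B) i j = A i j \<ominus> B i j"
proof -
  interpret S: ring "T n"
    by (rule ring_upper_triangular)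
  have "\<ominus>\<^bsub>T n\<^esub> B = (\<lambda>i j. \<ominus> B i j)"
  proof (rule S.minus_equality)
    show "(\<lambda>i j. \<ominus> B i j) \<in> carrier (T n)"
      using B by (auto simp: triangular_carrier_iff)
    show "(\<lambda>i j. \<ominus> B i j) \<oplus>\<^bsub>T n\<^esub> B = \<zero>\<^bsub>T n\<^esub>"
      using B by (intro ext) (simp add: triangular_simps l_neg)
  qed (rule B)
  then show ?thesis
    by (simp add: minus_eq S.minus_eq triangular_simps)
qed

section \<open>Diagonal entries, triangular systems, units and \<Delta> of
  \<open>T n\<close>\<close>

lemma triangular_mult_diag:
  assumes A: "A \<in> carrier (T n)" and B: "B \<in> carrier (T n)"
  shows "(A \<otimes>\<^bsub>T n\<^esub> B) i i = A i i \<otimes> B i i"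
proof (cases "i < n")
  case True
  have "A i k \<otimes> B k i = \<zero>" if "k \<noteq> i" for k
    using that A B triangular_entry_zero[OF A, of i k] triangular_entry_zero[OF B, of k i]
    by (cases "k < i") auto
  then show ?thesis
    unfolding triangular_simps using A B True by (intro finsum_eq_single) auto
next
  case False
  then show ?thesis
    using triangular_entry_zero[OF A] triangular_entry_zero[OF B]
      triangular_entry_zero[OF triangular_mult_closed[OF A B]] by simp
qed

text \<open>Back substitution: row \<open>i\<close> involves only the unknowns \<open>w k\<close>
  with \<open>k \<ge> i\<close>, and \<open>w i\<close> itself enters through
  \<open>C i i r - r b\<close>, which takes every value. The choice \<open>b = 0\<close> yields
  inverses; a diagonal entry as \<open>b\<close> yields the column equation for idempotents.\<close>

lemma triangular_system_solvable:
  assumes C: "C \<in> carrier (T n)" and m: "m \<le> n" and b: "b \<in> carrier R"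
    and v: "\<And>i. v i \<in> carrier R"
    and surj: "\<And>i. i < m \<Longrightarrow> lmult_minus_rmult R (C i i) b ` carrier R = carrier R"
  shows "\<exists>w. (\<forall>i. w i \<in> carrier R) \<and> (\<forall>i\<ge>m. w i = \<zero>) \<and>
    (\<forall>i<m. (\<Oplus>k\<in>{..<n}. C i k \<otimes> w k) \<ominus> w i \<otimes> b = v i)"
proof -
  \<comment> \<open>The bound \<open>0\<close> is what the induction varies: it descends from
    \<open>m\<close>, where no row has to be solved, to \<open>0\<close>, adding one row at a
    time.\<close>
  have "\<exists>w. (\<forall>i. w i \<in> carrier R) \<and> (\<forall>i\<ge>m. w i = \<zero>) \<and>
    (\<forall>i. 0 \<le> i \<and> i < m \<longrightarrow> (\<Oplus>k\<in>{..<n}. C i k \<otimes> w k) \<ominus> w i \<otimes> b = v i)"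
    using zero_le[of m]
  proof (induction rule: inc_induct)
    case base
    show ?case
      by (intro exI[of _ "\<lambda>_. \<zero>"]) auto
  next
    case (step s)
    then obtain w where w: "\<And>i. w i \<in> carrier R" "\<And>i. i \<ge> m \<Longrightarrow> w i = \<zero>"
      "\<And>i. \<lbrakk>Suc s \<le> i; i < m\<rbrakk> \<Longrightarrow> (\<Oplus>k\<in>{..<n}. C i k \<otimes> w k) \<ominus> w i \<otimes> b = v i"
      by blast
    \<comment> \<open>The part of row \<open>s\<close> that does not contain the new unknown.
      Columns left of \<open>s\<close> contribute nothing, since \<open>C\<close> is upper
      triangular.\<close>
    define c where "c = (\<Oplus>k\<in>{..<n} - {s}. C s k \<otimes> w k)"
    have c: "c \<in> carrier R"
      using C w by (auto simp: c_def)
    then have "v s \<ominus> c \<in> lmult_minus_rmult R (C s s) b ` carrier R"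
      using v surj[OF step(2)] by simp
    then obtain r where r: "r \<in> carrier R" "C s s \<otimes> r \<ominus> r \<otimes> b = v s \<ominus> c"
      by (auto simp: lmult_minus_rmult_def)
    define w' where "w' = w(s := r)"
    have w': "w' i \<in> carrier R" for i
      using w r by (simp add: w'_def)
    have "(\<Oplus>k\<in>{..<n}. C i k \<otimes> w' k) \<ominus> w' i \<otimes> b = v i" if i: "s \<le> i" "i < m" for i
    proof (cases "i = s")
      case True
      have "(\<Oplus>k\<in>{..<n}. C s k \<otimes> w' k) = (\<Oplus>k\<in>insert s ({..<n} - {s}). C s k \<otimes> w' k)"
        using step m by (simp add: insert_absorb)
      also have "\<dots> = C s s \<otimes> w' s \<oplus> (\<Oplus>k\<in>{..<n} - {s}. C s k \<otimes> w' k)"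
        using C w' by (intro finsum_insert) auto
      also have "(\<Oplus>k\<in>{..<n} - {s}. C s k \<otimes> w' k) = c"
        unfolding c_def using C w by (intro finsum_cong') (auto simp: w'_def)
      finally have "(\<Oplus>k\<in>{..<n}. C s k \<otimes> w' k) \<ominus> w' s \<otimes> b = C s s \<otimes> r \<ominus> r \<otimes> b \<oplus> c"
        using C c r b v by (simp add: w'_def minus_eq a_ac)
      also have "\<dots> = v s"
        using c v r by (simp add: minus_eq a_assoc l_neg)
      finally show ?thesis
        using True by simp
    next
      case False
      \<comment> \<open>Rows below \<open>s\<close> do not see the changed entry, so their equations
        survive.\<close>
      then have "C i s = \<zero>"
        using i by (intro triangular_entry_zero[OF C]) auto
      then have "(\<Oplus>k\<in>{..<n}. C i k \<otimes> w' k) = (\<Oplus>k\<in>{..<n}. C i k \<otimes> w k)"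
        using C w r by (intro finsum_cong') (auto simp: w'_def)
      then show ?thesis
        using False i w(3)[of i] by (simp add: w'_def)
    qed
    moreover have "w' i = \<zero>" if "i \<ge> m" for i
      using that step w by (simp add: w'_def)
    ultimately show ?case
      using w' by blast
  qed
  then show ?thesis
    by simp
qed

text \<open>Column \<open>j\<close> of the inverse solves a triangular system with
  \<open>b = 0\<close> and column \<open>j\<close> of the identity as target. Cutting the unknowns
  off at \<open>Suc j\<close> makes the result upper triangular.\<close>

lemma triangular_right_inverse:
  assumes A: "A \<in> carrier (T n)" and diag: "\<And>i. i < n \<Longrightarrow> A i i \<in> Units R"
  shows "\<exists>B\<in>carrier (T n). A \<otimes>\<^bsub>T n\<^esub> B = \<one>\<^bsub>T n\<^esub>"
proof -
  have surj: "lmult_minus_rmult R (A i i) \<zero> ` carrier R = carrier R" if "i < n" for i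
  proof -
    have "A i i \<otimes> (inv A i i \<otimes> r) = r" if "r \<in> carrier R" for r
      using that A diag[OF \<open>i < n\<close>] by (simp add: m_assoc[symmetric])
    then show ?thesis
      using A diag[OF that]
      by (force simp: lmult_minus_rmult_def minus_eq image_iff intro: bexI[of _ "inv A i i \<otimes> _"])
  qed
  have "\<exists>w. (\<forall>i. w i \<in> carrier R) \<and> (\<forall>i\<ge>Suc j. w i = \<zero>) \<and>
    (\<forall>i<Suc j. (\<Oplus>k\<in>{..<n}. A i k \<otimes> w k) \<ominus> w i \<otimes> \<zero> = \<one>\<^bsub>T n\<^esub> i j)" if "j < n" for j
    using that surj by (intro triangular_system_solvable[OF A]) (auto simp: triangular_simps)
  then have "\<forall>j\<in>{..<n}. \<exists>w. (\<forall>i. w i \<in> carrier R) \<and> (\<forall>i\<ge>Suc j. w i = \<zero>) \<and>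
    (\<forall>i<Suc j. (\<Oplus>k\<in>{..<n}. A i k \<otimes> w k) \<ominus> w i \<otimes> \<zero> = \<one>\<^bsub>T n\<^esub> i j)"
    by blast
  from bchoice[OF this] obtain w where w:
    "\<forall>j\<in>{..<n}. (\<forall>i. w j i \<in> carrier R) \<and> (\<forall>i\<ge>Suc j. w j i = \<zero>) \<and>
      (\<forall>i<Suc j. (\<Oplus>k\<in>{..<n}. A i k \<otimes> w j k) \<ominus> w j i \<otimes> \<zero> = \<one>\<^bsub>T n\<^esub> i j)" ..
  then have w_carrier: "w j i \<in> carrier R" and w_zero: "i > j \<Longrightarrow> w j i = \<zero>"
    and w_eq: "i \<le> j \<Longrightarrow> (\<Oplus>k\<in>{..<n}. A i k \<otimes> w j k) \<ominus> w j i \<otimes> \<zero> = \<one>\<^bsub>T n\<^esub> i j"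
    if "j < n" for i j
    using that unfolding less_Suc_eq_le Suc_le_eq by blast+
  define B where "B i j = (if j < n then w j i else \<zero>)" for i j
  have B: "B \<in> carrier (T n)"
    using w_carrier w_zero by (auto simp: B_def triangular_carrier_iff)
  have "A \<otimes>\<^bsub>T n\<^esub> B = \<one>\<^bsub>T n\<^esub>"
  proof (intro ext)
    fix i j
    show "(A \<otimes>\<^bsub>T n\<^esub> B) i j = \<one>\<^bsub>T n\<^esub> i j"
    proof (cases "i \<le> j \<and> j < n")
      case True
      have "(\<Oplus>k\<in>{..<n}. A i k \<otimes> w j k) \<in> carrier R"
        using A w_carrier True by (auto intro!: finsum_closed)
      then have "(\<Oplus>k\<in>{..<n}. A i k \<otimes> w j k) = \<one>\<^bsub>T n\<^esub> i j"
        using w_carrier[of j i] w_eq[of j i] True by (simp add: minus_eq)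
      then show ?thesis
        using True by (simp add: triangular_simps B_def)
    next
      case False
      then show ?thesis
        using triangular_entry_zero[OF triangular_mult_closed[OF A B]]
          triangular_entry_zero[OF triangular_one_closed] by simp
    qed
  qed
  with B show ?thesis
    by blast
qed

lemma triangular_unit_diag:
  assumes A: "A \<in> Units (T n)" and "i < n"
  shows "A i i \<in> Units R"
proof -
  obtain B where B: "B \<in> carrier (T n)" "A \<otimes>\<^bsub>T n\<^esub> B = \<one>\<^bsub>T n\<^esub>" "B \<otimes>\<^bsub>T n\<^esub> A = \<one>\<^bsub>T n\<^esub>"
    using A by (auto simp: Units_def)
  have A': "A \<in> carrier (T n)"
    using A by (auto simp: Units_def)
  have "A i i \<otimes> B i i = \<one>" "B i i \<otimes> A i i = \<one>"
    using B A' \<open>i < n\<close> triangular_mult_diag[of A n B i] triangular_mult_diag[of B n A i]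
    by (simp_all add: triangular_simps(3))
  then show ?thesis
    using A' B by (auto simp: Units_def)
qed

text \<open>A right inverse \<open>B\<close> of \<open>A\<close> has the inverse entries on its
  diagonal, so it has a right inverse \<open>C\<close> itself. Then \<open>A = C\<close>, and
  \<open>B\<close> is two-sided.\<close>

lemma triangular_Units_iff:
  assumes A: "A \<in> carrier (T n)"
  shows "A \<in> Units (T n) \<longleftrightarrow> (\<forall>i<n. A i i \<in> Units R)"
proof
  assume diag: "\<forall>i<n. A i i \<in> Units R"
  interpret S: ring "T n"
    by (rule ring_upper_triangular)
  obtain B where B: "B \<in> carrier (T n)" "A \<otimes>\<^bsub>T n\<^esub> B = \<one>\<^bsub>T n\<^esub>"
    using triangular_right_inverse A diag by blast
  have "B i i = inv A i i" if "i < n" for i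
    using that A B diag triangular_mult_diag[OF A B(1), of i]
    by (metis (full_types) Units_inv_closed Units_l_inv inv_unique triangular_entry triangular_simps(3))
  then obtain C where C: "C \<in> carrier (T n)" "B \<otimes>\<^bsub>T n\<^esub> C = \<one>\<^bsub>T n\<^esub>"
    using triangular_right_inverse[OF B(1)] diag by auto
  have "A = C"
    using A B C by (metis S.inv_unique)
  then show "A \<in> Units (T n)"
    using A B C by (auto simp: Units_def)
qed (use triangular_unit_diag in blast)

end

text \<open>Invertibility of \<open>1 - D U\<close> is decided on the diagonal, by the elements
  \<open>1 - D i i U i i\<close> of \<open>R\<close>. These are units when \<open>D i i\<close> lies
  in \<open>J(R)\<close>, which is a two-sided ideal.\<close>

lemma (in local_ring) delta_triangular:
  "delta (T n) = {D \<in> carrier (T n). \<forall>i<n. D i i \<in> jacobson_radical R}"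
proof (intro equalityI subsetI)
  fix D assume D: "D \<in> delta (T n)"
  interpret S: ring "T n"
    by (rule ring_upper_triangular)
  have D': "D \<in> carrier (T n)"
    using D by (simp add: delta_def)
  have "D i i \<in> jacobson_radical R" if "i < n" for i
  proof (rule ccontr)
    assume "D i i \<notin> jacobson_radical R"
    then have u: "D i i \<in> Units R"
      using D' by (simp add: Units_local)
    \<comment> \<open>A diagonal unit chosen to cancel \<open>D i i\<close>: the entry of
      \<open>1 - D U\<close> at \<open>(i, i)\<close> becomes \<open>0\<close>.\<close>
    define U where "U k l = (if k = l \<and> k < n then (if k = i then inv D i i else \<one>) else \<zero>)" for k l
    have U: "U \<in> carrier (T n)"
      using u by (auto simp: U_def triangular_carrier_iff)
    then have "U \<in> Units (T n)"
      using u by (auto simp: triangular_Units_iff U_def)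
    then have "\<one>\<^bsub>T n\<^esub> \<ominus>\<^bsub>T n\<^esub> D \<otimes>\<^bsub>T n\<^esub> U \<in> Units (T n)"
      using D by (simp add: delta_def)
    then have "(\<one>\<^bsub>T n\<^esub> \<ominus>\<^bsub>T n\<^esub> D \<otimes>\<^bsub>T n\<^esub> U) i i \<in> Units R"
      using triangular_unit_diag that by blast
    moreover have "(\<one>\<^bsub>T n\<^esub> \<ominus>\<^bsub>T n\<^esub> D \<otimes>\<^bsub>T n\<^esub> U) i i = \<zero>"
      using D' U that u by (simp add: triangular_minus triangular_mult_diag triangular_simps(3))
        (simp add: U_def minus_eq r_neg)
    ultimately show False
      using radical.zero_closed radical_not_unit by simp
  qed
  with D' show "D \<in> {D \<in> carrier (T n). \<forall>i<n. D i i \<in> jacobson_radical R}"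
    by blast
next
  fix D assume D: "D \<in> {D \<in> carrier (T n). \<forall>i<n. D i i \<in> jacobson_radical R}"
  interpret S: ring "T n"
    by (rule ring_upper_triangular)
  have "\<one>\<^bsub>T n\<^esub> \<ominus>\<^bsub>T n\<^esub> D \<otimes>\<^bsub>T n\<^esub> U \<in> Units (T n)" if U: "U \<in> Units (T n)" for U
  proof -
    have U': "U \<in> carrier (T n)"
      using U by (rule S.Units_closed)
    have "\<one> \<ominus> D i i \<otimes> U i i \<in> Units R" if "i < n" for i
      using that D U' by (auto intro!: unit_minus_radical radical_r_mult_closed)
    then show ?thesis
      using D U' by (simp add: triangular_Units_iff triangular_minus triangular_mult_diag
          triangular_simps(3))
  qed
  with D show "D \<in> delta (T n)"
    by (auto simp: delta_def)
qed

section \<open>Extending an idempotent by one row and column\<close>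

context ring
begin

text \<open>Insert \<open>u\<close> between the factors and reassociate. In the block computations
  below, \<open>u\<close> is the idempotent of the new diagonal position, and this rule and the next
  one discard the products of blocks that do not match.\<close>

lemma mult_zero_via_right_absorb:
  assumes "x \<in> carrier R" "y \<in> carrier R" "u \<in> carrier R" "x \<otimes> u = x" "u \<otimes> y = \<zero>"
  shows "x \<otimes> y = \<zero>"
  using assms by (metis m_assoc r_null)

lemma mult_zero_via_left_absorb:
  assumes "x \<in> carrier R" "y \<in> carrier R" "u \<in> carrier R" "x \<otimes> u = \<zero>" "u \<otimes> y = y"
  shows "x \<otimes> y = \<zero>"
  using assms by (metis m_assoc l_null)

lemma minus_eq_minus_imp_add_eq_add:
  assumes "a \<in> carrier R" "b \<in> carrier R" "c \<in> carrier R" "d \<in> carrier R"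
    and eq: "a \<ominus> b = c \<ominus> d"
  shows "a \<oplus> d = c \<oplus> b"
proof -
  have "a \<oplus> d = (a \<ominus> b) \<oplus> (b \<oplus> d)"
    using assms(1-4) by (simp add: minus_eq a_assoc r_neg1)
  also have "\<dots> = c \<oplus> b"
    unfolding eq using assms(1-4) by (simp add: minus_eq a_ac r_neg r_neg2)
  finally show ?thesis .
qed

text \<open>Block matrices in an abstract ring: the relations with \<open>u\<close> place
  \<open>A\<close> and \<open>F\<close> in the leading block, \<open>V\<close> and \<open>W\<close>
  in the new column above the diagonal, and \<open>B\<close> at the new diagonal position. For
  \<open>E = (F W; 0 1)\<close>, idempotence reduces to \<open>F W = 0\<close> and commutation to
  \<open>F V + W B = A W + V\<close>.\<close>

lemma idempotent_extension_one:
  assumes carr: "A \<in> carrier R" "V \<in> carrier R" "B \<in> carrier R" "F \<in> carrier R" "W \<in> carrier R"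
      "u \<in> carrier R"
    and u: "u \<otimes> u = u" "A \<otimes> u = \<zero>" "u \<otimes> A = \<zero>" "F \<otimes> u = \<zero>" "u \<otimes> F = \<zero>" "V \<otimes> u = V" "u \<otimes> V = \<zero>"
      "B \<otimes> u = B" "u \<otimes> B = B" "W \<otimes> u = W" "u \<otimes> W = \<zero>"
    and F: "F \<otimes> F = F" "F \<otimes> A = A \<otimes> F"
    and W: "F \<otimes> W = \<zero>" "A \<otimes> W \<ominus> W \<otimes> B = F \<otimes> V \<ominus> V"
  defines "E \<equiv> F \<oplus> W \<oplus> u"
  shows "E \<otimes> E = E" and "E \<otimes> (A \<oplus> V \<oplus> B) = (A \<oplus> V \<oplus> B) \<otimes> E"
proof -
  \<comment> \<open>Each left factor absorbs \<open>u\<close> on its right, and each right factor is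
    killed by \<open>u\<close> on its left.\<close>
  have z: "W \<otimes> F = \<zero>" "W \<otimes> W = \<zero>" "W \<otimes> A = \<zero>" "W \<otimes> V = \<zero>" "V \<otimes> F = \<zero>"
    "V \<otimes> W = \<zero>" "B \<otimes> F = \<zero>" "B \<otimes> W = \<zero>"
    by (rule mult_zero_via_right_absorb[where u = u]; simp add: carr u)+
  have z': "F \<otimes> B = \<zero>"
    by (rule mult_zero_via_left_absorb[where u = u]) (simp_all add: carr u)
  show "E \<otimes> E = E"
    unfolding E_def using carr u F W(1) z z' by (simp add: l_distr r_distr a_assoc)
  have add_eq: "A \<otimes> W \<oplus> V = F \<otimes> V \<oplus> W \<otimes> B"
    using minus_eq_minus_imp_add_eq_add[OF _ _ _ _ W(2)] carr by simp
  have "E \<otimes> (A \<oplus> V \<oplus> B) = A \<otimes> F \<oplus> (F \<otimes> V \<oplus> W \<otimes> B) \<oplus> B"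
    unfolding E_def using carr u F z z' by (simp add: l_distr r_distr a_assoc)
  also have "\<dots> = (A \<oplus> V \<oplus> B) \<otimes> E"
    unfolding E_def add_eq[symmetric] using carr u z by (simp add: l_distr r_distr a_assoc)
  finally show "E \<otimes> (A \<oplus> V \<oplus> B) = (A \<oplus> V \<oplus> B) \<otimes> E" .
qed

text \<open>The same blocks with \<open>E = (F W; 0 0)\<close>: idempotence now reduces to
  \<open>F W = W\<close> and commutation to \<open>A W = F V + W B\<close>.\<close>

lemma idempotent_extension_zero:
  assumes carr: "A \<in> carrier R" "V \<in> carrier R" "B \<in> carrier R" "F \<in> carrier R" "W \<in> carrier R"
      "u \<in> carrier R"
    and u: "A \<otimes> u = \<zero>" "u \<otimes> A = \<zero>" "F \<otimes> u = \<zero>" "u \<otimes> F = \<zero>" "V \<otimes> u = V" "u \<otimes> V = \<zero>"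
      "B \<otimes> u = B" "u \<otimes> B = B" "W \<otimes> u = W" "u \<otimes> W = \<zero>"
    and F: "F \<otimes> F = F" "F \<otimes> A = A \<otimes> F"
    and W: "F \<otimes> W = W" "A \<otimes> W \<ominus> W \<otimes> B = F \<otimes> V"
  defines "E \<equiv> F \<oplus> W"
  shows "E \<otimes> E = E" and "E \<otimes> (A \<oplus> V \<oplus> B) = (A \<oplus> V \<oplus> B) \<otimes> E"
proof -
  have z: "W \<otimes> F = \<zero>" "W \<otimes> W = \<zero>" "W \<otimes> A = \<zero>" "W \<otimes> V = \<zero>" "V \<otimes> F = \<zero>"
    "V \<otimes> W = \<zero>" "B \<otimes> F = \<zero>" "B \<otimes> W = \<zero>"
    by (rule mult_zero_via_right_absorb[where u = u]; simp add: carr u)+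
  have z': "F \<otimes> B = \<zero>"
    by (rule mult_zero_via_left_absorb[where u = u]) (simp_all add: carr u)
  show "E \<otimes> E = E"
    unfolding E_def using carr F W(1) z z' by (simp add: l_distr r_distr)
  have "A \<otimes> W \<ominus> W \<otimes> B = F \<otimes> V \<ominus> \<zero>"
    using W(2) carr by (simp add: minus_eq)
  then have add_eq: "A \<otimes> W = F \<otimes> V \<oplus> W \<otimes> B"
    using minus_eq_minus_imp_add_eq_add[of "A \<otimes> W" "W \<otimes> B" "F \<otimes> V" \<zero>] carr by simp
  have "E \<otimes> (A \<oplus> V \<oplus> B) = A \<otimes> F \<oplus> (F \<otimes> V \<oplus> W \<otimes> B)"
    unfolding E_def using carr F z z' by (simp add: l_distr r_distr a_assoc)
  also have "\<dots> = (A \<oplus> V \<oplus> B) \<otimes> E"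
    unfolding E_def add_eq[symmetric] using carr z by (simp add: l_distr r_distr a_assoc)
  finally show "E \<otimes> (A \<oplus> V \<oplus> B) = (A \<oplus> V \<oplus> B) \<otimes> E" .
qed

text \<open>Left multiplication by \<open>F\<close> kills both \<open>A (1 - F) W\<close> and
  \<open>F V - V\<close>, so the equation forces \<open>F W B = 0\<close>. Hence
  \<open>W' B = W B\<close>, while \<open>A (1 - F) W\<close> is \<open>A W'\<close>.\<close>

lemma project_solution_one:
  assumes carr: "A \<in> carrier R" "V \<in> carrier R" "B \<in> carrier R" "F \<in> carrier R" "W \<in> carrier R"
    and F: "F \<otimes> F = F" "F \<otimes> A = A \<otimes> F"
    and eq: "A \<otimes> (\<one> \<ominus> F) \<otimes> W \<ominus> W \<otimes> B = F \<otimes> V \<ominus> V"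
  defines "W' \<equiv> (\<one> \<ominus> F) \<otimes> W"
  shows "F \<otimes> W' = \<zero>" and "A \<otimes> W' \<ominus> W' \<otimes> B = F \<otimes> V \<ominus> V"
proof -
  have FG: "F \<otimes> (\<one> \<ominus> F) = \<zero>"
    using carr F by (simp add: minus_eq r_distr r_minus r_neg)
  show "F \<otimes> W' = \<zero>"
    unfolding W'_def using carr FG by (simp add: m_assoc[symmetric])
  have "F \<otimes> (A \<otimes> (\<one> \<ominus> F) \<otimes> W) = A \<otimes> (F \<otimes> (\<one> \<ominus> F)) \<otimes> W"
    using carr F by (simp add: m_assoc[symmetric])
  then have "F \<otimes> (A \<otimes> (\<one> \<ominus> F) \<otimes> W) = \<zero>"
    using FG carr by simp
  moreover have "F \<otimes> (F \<otimes> V \<ominus> V) = \<zero>"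
    using carr F by (simp add: minus_eq r_distr r_minus r_neg m_assoc[symmetric])
  ultimately have "\<ominus> (F \<otimes> (W \<otimes> B)) = \<zero>"
    using carr arg_cong[OF eq, of "\<lambda>x. F \<otimes> x"] by (simp add: minus_eq r_distr r_minus)
  then have FWB: "F \<otimes> (W \<otimes> B) = \<zero>"
    using carr by (metis m_closed minus_minus minus_zero)
  have "W' \<otimes> B = W \<otimes> B"
    unfolding W'_def using carr FWB by (simp add: minus_eq l_distr l_minus m_assoc)
  then show "A \<otimes> W' \<ominus> W' \<otimes> B = F \<otimes> V \<ominus> V"
    using eq carr by (simp add: W'_def m_assoc)
qed

text \<open>Multiply the equation by \<open>F\<close> from the left. Since \<open>F\<close> commutes
  with \<open>A\<close>, \<open>F (A F + (1 - F)) = A F\<close>, and what remains is the equation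
  for \<open>W' = F W\<close>.\<close>

lemma project_solution_zero:
  assumes carr: "A \<in> carrier R" "V \<in> carrier R" "B \<in> carrier R" "F \<in> carrier R" "W \<in> carrier R"
    and F: "F \<otimes> F = F" "F \<otimes> A = A \<otimes> F"
    and eq: "(A \<otimes> F \<oplus> (\<one> \<ominus> F)) \<otimes> W \<ominus> W \<otimes> B = F \<otimes> V"
  defines "W' \<equiv> F \<otimes> W"
  shows "F \<otimes> W' = W'" and "A \<otimes> W' \<ominus> W' \<otimes> B = F \<otimes> V"
proof -
  have FG: "F \<otimes> (\<one> \<ominus> F) = \<zero>"
    using carr F by (simp add: minus_eq r_distr r_minus r_neg)
  show "F \<otimes> W' = W'"
    unfolding W'_def using carr F by (simp add: m_assoc[symmetric])
  have "F \<otimes> (A \<otimes> F \<oplus> (\<one> \<ominus> F)) = A \<otimes> F"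
    using carr F FG by (simp add: r_distr m_assoc[symmetric]) (simp add: F m_assoc)
  then have "F \<otimes> ((A \<otimes> F \<oplus> (\<one> \<ominus> F)) \<otimes> W) = A \<otimes> W'"
    unfolding W'_def using carr by (simp add: m_assoc[symmetric])
  moreover have "F \<otimes> (F \<otimes> V) = F \<otimes> V"
    using carr F by (simp add: m_assoc[symmetric])
  ultimately show "A \<otimes> W' \<ominus> W' \<otimes> B = F \<otimes> V"
    using carr arg_cong[OF eq, of "\<lambda>x. F \<otimes> x"]
    by (simp add: minus_eq r_distr r_minus W'_def m_assoc)
qed

text \<open>\<open>corner m \<one>\<close> is the idempotent \<open>u\<close> of the block lemmas
  and \<open>corner m b\<close> the block \<open>B\<close>. Inside \<open>T n\<close>, the
  conditions \<open>V u = V\<close> and \<open>u V = 0\<close> confine \<open>V\<close> to column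
  \<open>m\<close> strictly above the diagonal.\<close>

definition corner :: "nat \<Rightarrow> 'a \<Rightarrow> nat \<Rightarrow> nat \<Rightarrow> 'a" where
  "corner m b = (\<lambda>i j. if i = m \<and> j = m then b else \<zero>)"

lemma corner_closed: "\<lbrakk>m < n; b \<in> carrier R\<rbrakk> \<Longrightarrow> corner m b \<in> carrier (T n)"
  by (auto simp: corner_def triangular_carrier_iff)

lemma mult_corner:
  assumes "A \<in> carrier (T n)" "m < n" "b \<in> carrier R"
  shows "(A \<otimes>\<^bsub>T n\<^esub> corner m b) i j = (if j = m then A i m \<otimes> b else \<zero>)"
proof -
  have "(A \<otimes>\<^bsub>T n\<^esub> corner m b) i j = A i m \<otimes> corner m b m j"
    unfolding triangular_simps using assms by (intro finsum_eq_single) (auto simp: corner_def)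
  then show ?thesis
    using assms by (simp add: corner_def)
qed

lemma corner_mult:
  assumes "A \<in> carrier (T n)" "m < n" "b \<in> carrier R"
  shows "(corner m b \<otimes>\<^bsub>T n\<^esub> A) i j = (if i = m then b \<otimes> A m j else \<zero>)"
proof -
  have "(corner m b \<otimes>\<^bsub>T n\<^esub> A) i j = corner m b i m \<otimes> A m j"
    unfolding triangular_simps using assms by (intro finsum_eq_single) (auto simp: corner_def)
  then show ?thesis
    using assms by (simp add: corner_def)
qed

text \<open>As \<open>V\<close> and the unknown \<open>W\<close> live in column \<open>m\<close>
  above the diagonal, where right multiplication by \<open>corner m b\<close> is right
  multiplication by \<open>b\<close>, the matrix equation is a single triangular system for that
  column.\<close>

lemma column_equation_solvable:
  assumes C: "C \<in> carrier (T n)" and m: "m < n" and b: "b \<in> carrier R" and V: "V \<in> carrier (T n)"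
    and Vm: "V \<otimes>\<^bsub>T n\<^esub> corner m \<one> = V" "corner m \<one> \<otimes>\<^bsub>T n\<^esub> V = \<zero>\<^bsub>T n\<^esub>"
    and surj: "\<And>i. i < m \<Longrightarrow> lmult_minus_rmult R (C i i) b ` carrier R = carrier R"
  shows "\<exists>W\<in>carrier (T n). W \<otimes>\<^bsub>T n\<^esub> corner m \<one> = W \<and> corner m \<one> \<otimes>\<^bsub>T n\<^esub> W = \<zero>\<^bsub>T n\<^esub> \<and>
    C \<otimes>\<^bsub>T n\<^esub> W \<ominus>\<^bsub>T n\<^esub> W \<otimes>\<^bsub>T n\<^esub> corner m b = V"
proof -
  have V_zero: "V i j = \<zero>" if "\<not> (i < m \<and> j = m)" for i j
  proof (cases "j = m")
    case False
    then show ?thesis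
      using fun_cong[OF fun_cong[OF Vm(1)], of i j] mult_corner[OF V m] by simp
  next
    case True
    then show ?thesis
      using fun_cong[OF fun_cong[OF Vm(2)], of m m] corner_mult[OF V m] V that
        triangular_entry_zero[OF V, of i j] by (cases "i = m") (auto simp: triangular_simps)
  qed
  obtain w where w: "\<forall>i. w i \<in> carrier R" "\<forall>i\<ge>m. w i = \<zero>"
    "\<forall>i<m. (\<Oplus>k\<in>{..<n}. C i k \<otimes> w k) \<ominus> w i \<otimes> b = V i m"
    using triangular_system_solvable[OF C less_imp_le[OF m] b _ surj, of "\<lambda>i. V i m"] V by auto
  define W where "W = (\<lambda>i j. if j = m then w i else \<zero>)"
  have W: "W \<in> carrier (T n)"
    using w m by (auto simp: W_def triangular_carrier_iff)
  have "(C \<otimes>\<^bsub>T n\<^esub> W \<ominus>\<^bsub>T n\<^esub> W \<otimes>\<^bsub>T n\<^esub> corner m b) i j = V i j" for i j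
  proof -
    have "(C \<otimes>\<^bsub>T n\<^esub> W \<ominus>\<^bsub>T n\<^esub> W \<otimes>\<^bsub>T n\<^esub> corner m b) i j =
        (\<Oplus>k\<in>{..<n}. C i k \<otimes> W k j) \<ominus> (if j = m then W i m \<otimes> b else \<zero>)"
      using C W m b
      by (simp add: triangular_minus triangular_mult_closed corner_closed mult_corner)
        (simp add: triangular_simps)
    also have "\<dots> = V i j"
    proof (cases "i < m \<and> j = m")
      case True
      then show ?thesis
        using w by (simp add: W_def)
    next
      case False
      \<comment> \<open>Outside the column above the diagonal both sides vanish. For
        \<open>j = m\<close> and \<open>k < m\<close> the row satisfies
        \<open>i \<ge> m > k\<close>, so \<open>C i k\<close> is below the diagonal; in all other
        cases \<open>W k j\<close> is zero.\<close>
      have "C i k \<otimes> W k j = \<zero>" for k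
      proof (cases "j = m \<and> k < m")
        case True
        then have "C i k = \<zero>"
          using False by (intro triangular_entry_zero[OF C]) auto
        then show ?thesis
          using W by simp
      next
        case False
        then show ?thesis
          using C w by (auto simp: W_def)
      qed
      then have "(\<Oplus>k\<in>{..<n}. C i k \<otimes> W k j) = \<zero>"
        by simp
      then show ?thesis
        using False V_zero[OF False] w b by (auto simp: W_def minus_eq)
    qed
    finally show ?thesis .
  qed
  then have "C \<otimes>\<^bsub>T n\<^esub> W \<ominus>\<^bsub>T n\<^esub> W \<otimes>\<^bsub>T n\<^esub> corner m b = V"
    by blast
  moreover have "W \<otimes>\<^bsub>T n\<^esub> corner m \<one> = W" "corner m \<one> \<otimes>\<^bsub>T n\<^esub> W = \<zero>\<^bsub>T n\<^esub>"
    using W m w by (auto simp: fun_eq_iff mult_corner corner_mult triangular_simps(4))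
      (auto simp: W_def)
  ultimately show ?thesis
    using W by blast
qed

lemma corner_corner:
  assumes "m < n" "a \<in> carrier R" "b \<in> carrier R"
  shows "corner m a \<otimes>\<^bsub>T n\<^esub> corner m b = corner m (a \<otimes> b)"
  using assms by (auto simp: fun_eq_iff mult_corner corner_closed) (auto simp: corner_def)

text \<open>The block form \<open>(A' V; 0 b)\<close> as a sum inside one ring \<open>T n\<close>,
  with the smaller block padded by zeros.\<close>

lemma triangular_split_column:
  assumes A: "A \<in> carrier (T n)" and m: "m < n" and supp: "\<And>i j. Suc m \<le> j \<Longrightarrow> A i j = \<zero>"
  obtains A' V where "A' \<in> carrier (T n)" "V \<in> carrier (T n)"
    "A = A' \<oplus>\<^bsub>T n\<^esub> V \<oplus>\<^bsub>T n\<^esub> corner m (A m m)"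
    "\<And>i j. m \<le> j \<Longrightarrow> A' i j = \<zero>" "\<And>i. i < m \<Longrightarrow> A' i i = A i i"
    "V \<otimes>\<^bsub>T n\<^esub> corner m \<one> = V" "corner m \<one> \<otimes>\<^bsub>T n\<^esub> V = \<zero>\<^bsub>T n\<^esub>"
proof -
  define A' V where A'_def: "A' = (\<lambda>i j. if j < m then A i j else \<zero>)"
    and V_def: "V = (\<lambda>i j. if i < m \<and> j = m then A i j else \<zero>)"
  have A': "A' \<in> carrier (T n)" and V: "V \<in> carrier (T n)"
    using A by (auto simp: triangular_carrier_iff A'_def V_def)
  have "A = A' \<oplus>\<^bsub>T n\<^esub> V \<oplus>\<^bsub>T n\<^esub> corner m (A m m)"
  proof (intro ext)
    fix i j
    show "A i j = (A' \<oplus>\<^bsub>T n\<^esub> V \<oplus>\<^bsub>T n\<^esub> corner m (A m m)) i j"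
      using A supp[of j i] triangular_entry_zero[OF A, of i j]
      by (cases j m rule: linorder_cases) (auto simp: triangular_simps A'_def V_def corner_def not_less_eq_eq)
  qed
  moreover have "V \<otimes>\<^bsub>T n\<^esub> corner m \<one> = V" "corner m \<one> \<otimes>\<^bsub>T n\<^esub> V = \<zero>\<^bsub>T n\<^esub>"
    using V m by (auto simp: fun_eq_iff mult_corner corner_mult triangular_simps(4))
      (auto simp: V_def)
  ultimately show thesis
    using that A' V by (simp add: A'_def)
qed

lemma corner_orthogonal:
  assumes A: "A \<in> carrier (T n)" and m: "m < n" and supp: "\<And>i j. m \<le> j \<Longrightarrow> A i j = \<zero>"
  shows "A \<otimes>\<^bsub>T n\<^esub> corner m \<one> = \<zero>\<^bsub>T n\<^esub>" "corner m \<one> \<otimes>\<^bsub>T n\<^esub> A = \<zero>\<^bsub>T n\<^esub>"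
proof -
  \<comment> \<open>Row \<open>m\<close> vanishes too: from column \<open>m\<close> on by the
    support condition, before it by triangularity.\<close>
  have "A m j = \<zero>" for j
    using supp triangular_entry_zero[OF A, of m j] by (cases "m \<le> j") auto
  then show "A \<otimes>\<^bsub>T n\<^esub> corner m \<one> = \<zero>\<^bsub>T n\<^esub>" "corner m \<one> \<otimes>\<^bsub>T n\<^esub> A = \<zero>\<^bsub>T n\<^esub>"
    using A m supp by (auto simp: fun_eq_iff mult_corner corner_mult triangular_simps(4))
qed

end

text \<open>The size \<open>n\<close> stays fixed while \<open>m\<close> grows. A leading block of
  size \<open>m\<close> is represented by a matrix of \<open>T n\<close> that vanishes from column
  \<open>m\<close> on, so all stages of the induction take place in the same ring.\<close>

lemma (in bleached_ring) exists_commuting_idempotent: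
  assumes two: "\<And>a. a \<in> carrier R \<Longrightarrow> a \<in> jacobson_radical R \<or> a \<ominus> \<one> \<in> jacobson_radical R"
    and "m \<le> n" and "A \<in> carrier (T n)" and "\<And>i j. m \<le> j \<Longrightarrow> A i j = \<zero>"
  shows "\<exists>E\<in>carrier (T n). (\<forall>i j. m \<le> j \<longrightarrow> E i j = \<zero>) \<and> E \<otimes>\<^bsub>T n\<^esub> E = E \<and>
    E \<otimes>\<^bsub>T n\<^esub> A = A \<otimes>\<^bsub>T n\<^esub> E \<and> (\<forall>i<m. A i i \<ominus> E i i \<in> jacobson_radical R)"
  using assms(2-)
proof (induction m arbitrary: A)
  case 0
  interpret S: ring "T n"
    by (rule ring_upper_triangular)
  show ?case
  proof (intro bexI conjI allI impI)
    show "\<zero>\<^bsub>T n\<^esub> i j = \<zero>" for i j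
      by (rule triangular_simps(4))
    show "\<zero>\<^bsub>T n\<^esub> \<otimes>\<^bsub>T n\<^esub> A = A \<otimes>\<^bsub>T n\<^esub> \<zero>\<^bsub>T n\<^esub>"
      using S.l_null[OF 0(2)] S.r_null[OF 0(2)] by simp
  qed simp_all
next
  case (Suc m)
  interpret S: ring "T n"
    by (rule ring_upper_triangular)
  let ?J = "jacobson_radical R"
  have m: "m < n"
    using Suc.prems by simp
  obtain A' V where A': "A' \<in> carrier (T n)" and V: "V \<in> carrier (T n)"
    and A_eq: "A = A' \<oplus>\<^bsub>T n\<^esub> V \<oplus>\<^bsub>T n\<^esub> corner m (A m m)"
    and A'_zero: "\<And>i j. m \<le> j \<Longrightarrow> A' i j = \<zero>" and A'_diag: "\<And>i. i < m \<Longrightarrow> A' i i = A i i"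
    and Vu: "V \<otimes>\<^bsub>T n\<^esub> corner m \<one> = V" "corner m \<one> \<otimes>\<^bsub>T n\<^esub> V = \<zero>\<^bsub>T n\<^esub>"
    using triangular_split_column[OF Suc.prems(2) m Suc.prems(3)] by blast
  obtain F where F: "F \<in> carrier (T n)" and F_zero: "\<And>i j. m \<le> j \<Longrightarrow> F i j = \<zero>"
    and FF: "F \<otimes>\<^bsub>T n\<^esub> F = F" and FA: "F \<otimes>\<^bsub>T n\<^esub> A' = A' \<otimes>\<^bsub>T n\<^esub> F"
    and AF: "\<And>i. i < m \<Longrightarrow> A i i \<ominus> F i i \<in> ?J"
    using Suc.IH[OF _ A' A'_zero] m A'_diag by (metis less_imp_le)
  define b u where "b = A m m" and "u = corner m \<one>"
  have b: "b \<in> carrier R"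
    using Suc.prems by (simp add: b_def)
  define B where "B = corner m b"
  have B: "B \<in> carrier (T n)" and u: "u \<in> carrier (T n)"
    using b m by (simp_all add: B_def u_def corner_closed)
  have uu: "u \<otimes>\<^bsub>T n\<^esub> u = u" and Bu: "B \<otimes>\<^bsub>T n\<^esub> u = B" and uB: "u \<otimes>\<^bsub>T n\<^esub> B = B"
    using b m by (simp_all add: B_def u_def corner_corner)
  note A'u = corner_orthogonal[OF A' m A'_zero, folded u_def]
    and Fu = corner_orthogonal[OF F m F_zero, folded u_def]
  note Vu = Vu[folded u_def]
  note A_eq = A_eq[folded b_def, folded B_def]
  have F_diag: "F i i = (if F i i \<in> ?J then \<zero> else \<one>)" for i
    \<comment> \<open>Taking diagonals is multiplicative, so each \<open>F i i\<close> is an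
      idempotent of \<open>R\<close>.\<close>
    using F triangular_mult_diag[OF F F, of i] by (intro idempotent_local) (simp_all add: FF)
  have u_zero: "u i j = \<zero>" if "i < m \<or> Suc m \<le> j" for i j
    using that by (auto simp: u_def corner_def)
  have column_zero: "W i j = \<zero>"
    if "W \<in> carrier (T n)" "W \<otimes>\<^bsub>T n\<^esub> u = W" "u \<otimes>\<^bsub>T n\<^esub> W = \<zero>\<^bsub>T n\<^esub>" "j \<noteq> m \<or> i = m" for W i j
    using fun_cong[OF fun_cong[OF that(2)], of i j] fun_cong[OF fun_cong[OF that(3)], of i j] that(1,4) m
    by (auto simp: u_def mult_corner corner_mult triangular_simps(4) split: if_splits)
  show ?case
  proof (cases "b \<in> ?J")
    case False
    then have b_unit: "b \<in> Units R" and b_one: "b \<ominus> \<one> \<in> ?J"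
      using b two by (auto simp: Units_local)
    define C where "C = A' \<otimes>\<^bsub>T n\<^esub> (\<one>\<^bsub>T n\<^esub> \<ominus>\<^bsub>T n\<^esub> F)"
    have C: "C \<in> carrier (T n)"
      using A' F by (simp add: C_def)
    \<comment> \<open>Where \<open>F i i = 1\<close> the entry of \<open>C\<close> is
      \<open>0\<close>. Where \<open>F i i = 0\<close> it is \<open>A i i\<close>, which then lies
      in \<open>J(R)\<close>. With the unit \<open>b\<close> on the other side, bleachedness
      applies.\<close>
    have "C i i \<in> ?J" if "i < m" for i
    proof -
      have "C i i = A i i \<otimes> (\<one> \<ominus> F i i)"
        using A' F that m
        by (simp add: C_def triangular_mult_diag triangular_minus A'_diag triangular_simps(3))
      then show ?thesis
        using AF[OF that] Suc.prems(2) by (subst (asm) (1 2) F_diag)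
          (auto simp: minus_eq r_neg radical.zero_closed split: if_splits)
    qed
    then have surj: "lmult_minus_rmult R (C i i) b ` carrier R = carrier R" if "i < m" for i
      using that b_unit by (intro surj_radical_unit)
    have "F \<otimes>\<^bsub>T n\<^esub> V \<ominus>\<^bsub>T n\<^esub> V \<in> carrier (T n)"
      "(F \<otimes>\<^bsub>T n\<^esub> V \<ominus>\<^bsub>T n\<^esub> V) \<otimes>\<^bsub>T n\<^esub> u = F \<otimes>\<^bsub>T n\<^esub> V \<ominus>\<^bsub>T n\<^esub> V"
      "u \<otimes>\<^bsub>T n\<^esub> (F \<otimes>\<^bsub>T n\<^esub> V \<ominus>\<^bsub>T n\<^esub> V) = \<zero>\<^bsub>T n\<^esub>"
      using F V u Vu Fu by (simp_all add: S.minus_eq S.l_distr S.r_distr S.l_minus S.r_minus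
          S.m_assoc) (simp_all add: S.m_assoc[symmetric])
    from column_equation_solvable[OF C m b this[unfolded u_def] surj, folded u_def B_def]
    obtain W where W: "W \<in> carrier (T n)" "W \<otimes>\<^bsub>T n\<^esub> u = W" "u \<otimes>\<^bsub>T n\<^esub> W = \<zero>\<^bsub>T n\<^esub>"
      "C \<otimes>\<^bsub>T n\<^esub> W \<ominus>\<^bsub>T n\<^esub> W \<otimes>\<^bsub>T n\<^esub> B = F \<otimes>\<^bsub>T n\<^esub> V \<ominus>\<^bsub>T n\<^esub> V"
      by blast
    define W' where "W' = (\<one>\<^bsub>T n\<^esub> \<ominus>\<^bsub>T n\<^esub> F) \<otimes>\<^bsub>T n\<^esub> W"
    have W': "W' \<in> carrier (T n)" "W' \<otimes>\<^bsub>T n\<^esub> u = W'" "u \<otimes>\<^bsub>T n\<^esub> W' = \<zero>\<^bsub>T n\<^esub>"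
      using W F u Fu by (simp_all add: W'_def S.minus_eq S.l_distr S.r_distr S.l_minus S.r_minus
          S.m_assoc) (simp_all add: S.m_assoc[symmetric])
    note proj = S.project_solution_one[OF A' V B F W(1) FF FA W(4)[unfolded C_def], folded W'_def]
    note ext = S.idempotent_extension_one[OF A' V B F W'(1) u uu A'u Fu Vu Bu uB W'(2,3) FF FA proj]
    define E where "E = F \<oplus>\<^bsub>T n\<^esub> W' \<oplus>\<^bsub>T n\<^esub> u"
    have E: "E i j = F i j \<oplus> W' i j \<oplus> u i j" for i j
      by (simp add: E_def triangular_simps)
    have "E i j = \<zero>" if "Suc m \<le> j" for i j
      using that by (simp add: E F_zero column_zero[OF W'] u_zero)
    moreover have "A i i \<ominus> E i i \<in> ?J" if "i < Suc m" for i
    proof (cases "i = m")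
      case True
      then show ?thesis
        using b_one by (simp add: E F_zero column_zero[OF W']) (simp add: u_def corner_def b_def)
    next
      case False
      then show ?thesis
        using that AF[of i] F by (simp add: E column_zero[OF W'] u_zero)
    qed
    moreover have "E \<in> carrier (T n)"
      using F W' u by (simp add: E_def)
    ultimately show ?thesis
      using ext[folded E_def, folded A_eq] by blast
  next
    case True
    define C where "C = A' \<otimes>\<^bsub>T n\<^esub> F \<oplus>\<^bsub>T n\<^esub> (\<one>\<^bsub>T n\<^esub> \<ominus>\<^bsub>T n\<^esub> F)"
    have C: "C \<in> carrier (T n)"
      using A' F by (simp add: C_def)
    \<comment> \<open>The entry is \<open>1\<close> where \<open>F i i = 0\<close>, and
      \<open>A i i\<close> where \<open>F i i = 1\<close>. In the second case \<open>A i i\<close>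
      is congruent to \<open>1\<close> modulo \<open>J(R)\<close>, hence a unit.\<close>
    have "C i i \<in> Units R" if "i < m" for i
    proof -
      have C_ii: "C i i = A i i \<otimes> F i i \<oplus> (\<one> \<ominus> F i i)"
        using A' F that m
        by (simp add: C_def triangular_mult_diag triangular_minus A'_diag triangular_simps(2,3))
      show ?thesis
      proof (cases "F i i \<in> ?J")
        case True
        then have "F i i = \<zero>"
          using F_diag[of i] by simp
        then show ?thesis
          using C_ii Suc.prems(2) by (simp add: minus_eq)
      next
        case False
        then have F1: "F i i = \<one>"
          using F_diag[of i] by simp
        \<comment> \<open>\<open>A i i\<close> written as a unit minus an element of
          \<open>J(R)\<close>.\<close>
        have "\<one> \<ominus> \<ominus> (A i i \<ominus> \<one>) \<in> Units R"
          using AF[OF that] F1 by (intro unit_minus_radical) auto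
        moreover have "\<one> \<ominus> \<ominus> (A i i \<ominus> \<one>) = A i i"
          using Suc.prems(2) a_lcomm[of \<one> "A i i" "\<ominus> \<one>"] by (simp add: minus_eq r_neg)
        ultimately show ?thesis
          using C_ii F1 Suc.prems(2) by (simp add: minus_eq r_neg)
      qed
    qed
    then have surj: "lmult_minus_rmult R (C i i) b ` carrier R = carrier R" if "i < m" for i
      using that True by (intro surj_unit_radical)
    have "F \<otimes>\<^bsub>T n\<^esub> V \<in> carrier (T n)" "(F \<otimes>\<^bsub>T n\<^esub> V) \<otimes>\<^bsub>T n\<^esub> u = F \<otimes>\<^bsub>T n\<^esub> V"
      "u \<otimes>\<^bsub>T n\<^esub> (F \<otimes>\<^bsub>T n\<^esub> V) = \<zero>\<^bsub>T n\<^esub>"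
      using F V u Vu Fu by (simp_all add: S.m_assoc) (simp_all add: S.m_assoc[symmetric])
    from column_equation_solvable[OF C m b this[unfolded u_def] surj, folded u_def B_def]
    obtain W where W: "W \<in> carrier (T n)" "W \<otimes>\<^bsub>T n\<^esub> u = W" "u \<otimes>\<^bsub>T n\<^esub> W = \<zero>\<^bsub>T n\<^esub>"
      "C \<otimes>\<^bsub>T n\<^esub> W \<ominus>\<^bsub>T n\<^esub> W \<otimes>\<^bsub>T n\<^esub> B = F \<otimes>\<^bsub>T n\<^esub> V"
      by blast
    define W' where "W' = F \<otimes>\<^bsub>T n\<^esub> W"
    have W': "W' \<in> carrier (T n)" "W' \<otimes>\<^bsub>T n\<^esub> u = W'" "u \<otimes>\<^bsub>T n\<^esub> W' = \<zero>\<^bsub>T n\<^esub>"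
      using W F u Fu by (simp_all add: W'_def S.m_assoc) (simp_all add: S.m_assoc[symmetric])
    note proj = S.project_solution_zero[OF A' V B F W(1) FF FA W(4)[unfolded C_def], folded W'_def]
    note ext = S.idempotent_extension_zero[OF A' V B F W'(1) u A'u Fu Vu Bu uB W'(2,3) FF FA proj]
    define E where "E = F \<oplus>\<^bsub>T n\<^esub> W'"
    have E: "E i j = F i j \<oplus> W' i j" for i j
      by (simp add: E_def triangular_simps)
    have "E i j = \<zero>" if "Suc m \<le> j" for i j
      using that by (simp add: E F_zero column_zero[OF W'])
    moreover have "A i i \<ominus> E i i \<in> ?J" if "i < Suc m" for i
    proof (cases "i = m")
      case True
      then show ?thesis
        using \<open>b \<in> ?J\<close> by (simp add: E F_zero column_zero[OF W'] minus_eq b_def)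
    next
      case False
      then show ?thesis
        using that AF[of i] F by (simp add: E column_zero[OF W'])
    qed
    moreover have "E \<in> carrier (T n)"
      using F W' u by (simp add: E_def)
    ultimately show ?thesis
      using ext[folded E_def, folded A_eq] by blast
  qed
qed

text \<open>For \<open>m = n\<close> the support condition is part of membership in
  \<open>T n\<close>. The difference \<open>D = A - E\<close> has its diagonal in
  \<open>J(R)\<close>, and it commutes with \<open>E\<close> because \<open>A\<close> does.\<close>

lemma (in bleached_ring) strongly_delta_clean_triangular:
  assumes two: "\<And>a. a \<in> carrier R \<Longrightarrow> a \<in> jacobson_radical R \<or> a \<ominus> \<one> \<in> jacobson_radical R"
  shows "strongly_delta_clean_ring (T n)"
proof -
  interpret S: ring "T n"
    by (rule ring_upper_triangular)
  show ?thesis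
  proof (intro strongly_delta_clean_ring.intro strongly_delta_clean_ring_axioms.intro S.ring_axioms)
    fix A assume A: "A \<in> carrier (T n)"
    then obtain E where E: "E \<in> carrier (T n)" "E \<otimes>\<^bsub>T n\<^esub> E = E" "E \<otimes>\<^bsub>T n\<^esub> A = A \<otimes>\<^bsub>T n\<^esub> E"
      "\<forall>i<n. A i i \<ominus> E i i \<in> jacobson_radical R"
      using exists_commuting_idempotent[OF two order_refl A] triangular_entry_zero[OF A] by force
    define D where "D = A \<ominus>\<^bsub>T n\<^esub> E"
    have "D \<in> delta (T n)"
      using A E by (simp add: delta_triangular D_def triangular_minus)
    moreover have "A = E \<oplus>\<^bsub>T n\<^esub> D"
      using A E by (simp add: D_def S.minus_eq S.a_lcomm S.r_neg)
    moreover have "E \<otimes>\<^bsub>T n\<^esub> D = D \<otimes>\<^bsub>T n\<^esub> E"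
      using A E by (simp add: D_def S.minus_eq S.l_distr S.r_distr S.l_minus S.r_minus)
    ultimately show "\<exists>E\<in>carrier (T n). \<exists>D\<in>delta (T n). A = E \<oplus>\<^bsub>T n\<^esub> D \<and>
        E \<otimes>\<^bsub>T n\<^esub> E = E \<and> E \<otimes>\<^bsub>T n\<^esub> D = D \<otimes>\<^bsub>T n\<^esub> E"
      using E by blast
  qed
qed

section \<open>From strongly \<Delta>-clean triangular matrices back to the base ring\<close>

lemma (in ring) triangular_mult_entry_01:
  assumes A: "A \<in> carrier (T n)" and B: "B \<in> carrier (T n)" and n: "2 \<le> n"
  shows "(A \<otimes>\<^bsub>T n\<^esub> B) 0 1 = A 0 0 \<otimes> B 0 1 \<oplus> A 0 1 \<otimes> B 1 1"
proof -
  have "(A \<otimes>\<^bsub>T n\<^esub> B) 0 1 = (\<Oplus>k\<in>{0, 1}. A 0 k \<otimes> B k 1)"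
    unfolding triangular_simps
  proof (rule add.finprod_mono_neutral_cong_right)
    show "A 0 k \<otimes> B k 1 = \<zero>" if "k \<in> {..<n} - {0, 1}" for k
      using that A triangular_entry_zero[OF B, of k 1] by simp
  qed (use A B n in auto)
  also have "\<dots> = A 0 0 \<otimes> B 0 1 \<oplus> A 0 1 \<otimes> B 1 1"
    using A B by (simp add: finsum_insert)
  finally show ?thesis .
qed

context local_ring
begin

text \<open>On the diagonal \<open>E\<close> is \<open>0\<close> or \<open>1\<close> and
  \<open>D\<close> lies in \<open>J(R)\<close>, so each \<open>E i i\<close> records the residue
  class of \<open>A i i\<close>. Commutation with \<open>A = E + D\<close> follows from commutation
  with \<open>D\<close>.\<close>

lemma clean_triangular_decomposition:
  assumes clean: "strongly_delta_clean_ring (T n)" and A: "A \<in> carrier (T n)"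
  obtains E where "E \<in> carrier (T n)" "E \<otimes>\<^bsub>T n\<^esub> A = A \<otimes>\<^bsub>T n\<^esub> E"
    "\<And>i. i < n \<Longrightarrow> A i i \<in> jacobson_radical R \<and> E i i = \<zero> \<or>
      A i i \<ominus> \<one> \<in> jacobson_radical R \<and> E i i = \<one>"
proof -
  interpret S: strongly_delta_clean_ring "T n"
    by (rule clean)
  obtain E D where E: "E \<in> carrier (T n)" "E \<otimes>\<^bsub>T n\<^esub> E = E" and D: "D \<in> delta (T n)"
    and eq: "A = E \<oplus>\<^bsub>T n\<^esub> D" "E \<otimes>\<^bsub>T n\<^esub> D = D \<otimes>\<^bsub>T n\<^esub> E"
    using S.strongly_delta_clean[OF A] by blast
  have D': "D \<in> carrier (T n)" "\<And>i. i < n \<Longrightarrow> D i i \<in> jacobson_radical R"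
    using D by (auto simp: delta_triangular)
  have "E \<otimes>\<^bsub>T n\<^esub> A = A \<otimes>\<^bsub>T n\<^esub> E"
    using E D' eq(2) unfolding eq(1) by (simp add: S.l_distr S.r_distr)
  moreover have "A i i \<in> jacobson_radical R \<and> E i i = \<zero> \<or>
      A i i \<ominus> \<one> \<in> jacobson_radical R \<and> E i i = \<one>" if "i < n" for i
  proof -
    have "E i i \<otimes> E i i = E i i"
      using triangular_mult_diag[OF E(1) E(1)] E(2) by simp
    then have "E i i = \<zero> \<or> E i i = \<one>"
      using idempotent_local[of "E i i"] E(1) by (metis triangular_entry)
    moreover have "\<one> \<oplus> D i i \<ominus> \<one> = D i i"
      using D' by (subst a_comm) (simp_all add: minus_eq a_assoc r_neg)
    ultimately show ?thesis
      using D'(2)[OF that] by (auto simp: eq(1) triangular_simps(2))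
  qed
  ultimately show thesis
    using that E(1) by blast
qed

text \<open>Decompose the matrix whose only nonzero entry can be \<open>a\<close> in the upper left
  corner, and read off position \<open>(0, 0)\<close>.\<close>

lemma clean_triangular_two_elements:
  assumes clean: "strongly_delta_clean_ring (T n)" and n: "0 < n" and a: "a \<in> carrier R"
  shows "a \<in> jacobson_radical R \<or> a \<ominus> \<one> \<in> jacobson_radical R"
proof -
  have "corner 0 a \<in> carrier (T n)"
    using n a by (rule corner_closed)
  from clean_triangular_decomposition[OF clean this] show ?thesis
    using n by (metis (full_types) corner_def)
qed

text \<open>The test matrix is \<open>(a c; 0 b)\<close> padded by zeros. Position
  \<open>(0, 1)\<close> of \<open>E A = A E\<close> gives the equation, with
  \<open>r = E 0 1\<close>, \<open>e = E 0 0\<close> and \<open>f = E 1 1\<close>.\<close>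

lemma clean_triangular_commuting:
  assumes clean: "strongly_delta_clean_ring (T n)" and n: "2 \<le> n"
    and a: "a \<in> carrier R" and b: "b \<in> carrier R" and c: "c \<in> carrier R"
  obtains e r f where "r \<in> carrier R" "e \<otimes> c \<oplus> r \<otimes> b = a \<otimes> r \<oplus> c \<otimes> f"
    "a \<in> jacobson_radical R \<and> e = \<zero> \<or> a \<ominus> \<one> \<in> jacobson_radical R \<and> e = \<one>"
    "b \<in> jacobson_radical R \<and> f = \<zero> \<or> b \<ominus> \<one> \<in> jacobson_radical R \<and> f = \<one>"
proof -
  define A where "A = (\<lambda>(i::nat) (j::nat). if i = 0 \<and> j = 0 then a else if i = 0 \<and> j = 1 then c
    else if i = 1 \<and> j = 1 then b else \<zero>)"
  have A: "A \<in> carrier (T n)"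
    using a b c n by (auto simp: A_def triangular_carrier_iff)
  obtain E where E: "E \<in> carrier (T n)" and EA: "E \<otimes>\<^bsub>T n\<^esub> A = A \<otimes>\<^bsub>T n\<^esub> E"
    and diag: "\<And>i. i < n \<Longrightarrow> A i i \<in> jacobson_radical R \<and> E i i = \<zero> \<or>
      A i i \<ominus> \<one> \<in> jacobson_radical R \<and> E i i = \<one>"
    using clean_triangular_decomposition[OF clean A] by blast
  have entry: "A 0 0 = a" "A 0 1 = c" "A 1 1 = b"
    by (simp_all add: A_def)
  show thesis
  proof (rule that)
    show "E 0 1 \<in> carrier R"
      using E by simp
    show "E 0 0 \<otimes> c \<oplus> E 0 1 \<otimes> b = a \<otimes> E 0 1 \<oplus> c \<otimes> E 1 1"
      using fun_cong[OF fun_cong[OF EA], of 0 1] A E n by (simp only: triangular_mult_entry_01 entry)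
  qed (use diag[of 0] diag[of 1] n entry in simp_all)
qed

text \<open>For a unit and an element of \<open>J(R)\<close> on the diagonal, the residues determine
  \<open>e\<close> and \<open>f\<close> as different elements of \<open>{0, 1}\<close>. Then just
  one of \<open>e c\<close> and \<open>c f\<close> survives, and the equation presents the arbitrary
  \<open>c\<close>, up to sign, as a value of the required map.\<close>

lemma clean_triangular_bleached:
  assumes clean: "strongly_delta_clean_ring (T n)" and n: "2 \<le> n"
  shows "bleached_ring R"
proof -
  \<comment> \<open>This settles which alternative holds on the diagonal: \<open>x\<close> and
    \<open>x - 1\<close> cannot both lie in \<open>J(R)\<close>, since their difference is
    \<open>1\<close>.\<close>
  have unit_radical: "u \<ominus> \<one> \<in> jacobson_radical R \<and> x \<ominus> \<one> \<notin> jacobson_radical R"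
    if "u \<in> Units R" "x \<in> jacobson_radical R" for u x
  proof -
    have "u \<ominus> \<one> \<in> jacobson_radical R"
      using clean_triangular_two_elements[OF clean, of u] n that radical_not_unit
      by (auto simp: Units_closed)
    moreover have "x \<ominus> \<one> \<notin> jacobson_radical R"
    proof
      assume "x \<ominus> \<one> \<in> jacobson_radical R"
      then have "x \<ominus> (x \<ominus> \<one>) \<in> jacobson_radical R"
        by (rule radical_minus_closed[OF that(2)])
      moreover have "x \<ominus> (x \<ominus> \<one>) = \<one>"
        using that by (simp add: minus_eq minus_add r_neg2)
      ultimately show False
        using one_notin_radical by simp
    qed
    ultimately show ?thesis ..
  qed
  have surj: "lmult_minus_rmult R a b ` carrier R = carrier R"
    if a: "a \<in> carrier R" and b: "b \<in> carrier R"
      and sol: "\<And>c. c \<in> carrier R \<Longrightarrow> \<exists>r\<in>carrier R. a \<otimes> r \<ominus> r \<otimes> b = c" for a b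
    using a b sol by (fastforce simp: lmult_minus_rmult_def image_iff)
  show ?thesis
  proof (intro bleached_ring.intro bleached_ring_axioms.intro local_ring_axioms surj)
    fix a b c
    assume a: "a \<in> Units R" and b: "b \<in> jacobson_radical R" and c: "c \<in> carrier R"
    obtain e r f where r: "r \<in> carrier R" "e \<otimes> c \<oplus> r \<otimes> b = a \<otimes> r \<oplus> c \<otimes> f"
      "a \<in> jacobson_radical R \<and> e = \<zero> \<or> a \<ominus> \<one> \<in> jacobson_radical R \<and> e = \<one>"
      "b \<in> jacobson_radical R \<and> f = \<zero> \<or> b \<ominus> \<one> \<in> jacobson_radical R \<and> f = \<one>"
      using clean_triangular_commuting[OF clean n Units_closed[OF a] radical_carrier[OF b] c] .
    then have "e = \<one>" "f = \<zero>"
      using a b unit_radical[OF a b] radical_not_unit by auto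
    then have "a \<otimes> r = c \<oplus> r \<otimes> b"
      using r a b c by (simp add: Units_closed)
    then have "a \<otimes> r \<ominus> r \<otimes> b = c"
      using r b c by (simp add: minus_eq a_assoc r_neg)
    then show "\<exists>r\<in>carrier R. a \<otimes> r \<ominus> r \<otimes> b = c"
      using r by blast
  next
    fix a b c
    assume a: "a \<in> Units R" and b: "b \<in> jacobson_radical R" and c: "c \<in> carrier R"
    \<comment> \<open>With the roles exchanged, the surviving term is \<open>c f\<close> on the
      other side of the equation, so \<open>c\<close> enters with a minus sign.\<close>
    obtain e r f where r: "r \<in> carrier R" "e \<otimes> \<ominus> c \<oplus> r \<otimes> a = b \<otimes> r \<oplus> \<ominus> c \<otimes> f"
      "b \<in> jacobson_radical R \<and> e = \<zero> \<or> b \<ominus> \<one> \<in> jacobson_radical R \<and> e = \<one>"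
      "a \<in> jacobson_radical R \<and> f = \<zero> \<or> a \<ominus> \<one> \<in> jacobson_radical R \<and> f = \<one>"
      using clean_triangular_commuting[OF clean n radical_carrier[OF b] Units_closed[OF a]
          a_inv_closed[OF c]] .
    then have "e = \<zero>" "f = \<one>"
      using a b unit_radical[OF a b] radical_not_unit by auto
    then have "r \<otimes> a = b \<otimes> r \<oplus> \<ominus> c"
      using r a b c by (simp add: Units_closed)
    then have "b \<otimes> r \<ominus> r \<otimes> a = c"
      using r b c by (simp add: minus_eq minus_add r_neg2)
    then show "\<exists>r\<in>carrier R. b \<otimes> r \<ominus> r \<otimes> a = c"
      using r by blast
  qed (auto simp: Units_closed)
qed

end

theorem corollary4p6:
  fixes R :: "('a, 'm) ring_scheme" and n :: nat
  assumes "local_ring R" and "n \<ge> 2"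
  shows "strongly_delta_clean_ring (upper_triangular_ring n R) \<longleftrightarrow>
    bleached_ring R \<and> R Quot (jacobson_radical R) \<simeq> ZFact 2"
proof -
  interpret local_ring R
    by (rule assms(1))
  show ?thesis
    using assms(2) clean_triangular_bleached[of n] clean_triangular_two_elements[of n]
      quotient_two_elementsI quotient_two_elementsD bleached_ring.strongly_delta_clean_triangular[of R n]
    by fastforce
qed

end
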